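(* Let $(\Lambda,d)$ be a bounded metric space with Borel probability measure $\mu$, and let $F_t:\Lambda\to\Lambda$, $t\ge 0$, be a $\mu$-preserving semiflow such that $t\mapsto F_t$ is Lipschitz a.e. on $\Lambda$ (i.e. for $\mu$-a.e. $x\in\Lambda$ the map $t\mapsto F_t x$ is Lipschitz). Let $L_t:L^1(\Lambda)\to L^1(\Lambda)$ denote the transfer operator corresponding to $F_t$. Let $v\in L^\infty(\Lambda)$ and define $v_t=\int_0^t v\circ F_r\,dr$ for $t\ge 0$. Let $\eta\in(\frac12,1)$. Suppose that $L_tv\in C^\eta(\Lambda)$ for all $t>0$ and that $\int_0^\infty \|L_tv\|_\eta\,dt<\infty$. Then $v_t$ is a coboundary: \[ v_t=\chi\circ F_t-\chi \quad\text{for all } t\ge 0,\ \text{a.e. on } \Lambda, \] where $\chi=\int_0^\infty L_tv\,dt\in C^\eta(\Lambda)$. In particular, $\sup_{t\ge 0}|v_t|_\infty<\infty$.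
   Context: The spaces $L^1(\Lambda)$, $L^\infty(\Lambda)$ are taken with respect to $\mu$, and "a.e." means $\mu$-almost everywhere. The transfer operator $L_t:L^1(\Lambda)\to L^1(\Lambda)$ corresponding to $F_t$ is defined by $\int_\Lambda L_tv\,w\,d\mu=\int_\Lambda v\,w\circ F_t\,d\mu$ for all $v\in L^1(\Lambda)$, $w\in L^\infty(\Lambda)$, $t>0$. For a function $g$ on $\Lambda$, $|g|_\infty=\operatorname{ess\,sup}_\Lambda|g|$ and $\|g\|_\eta=|g|_\infty+\sup_{x\ne y}|g(x)-g(y)|/d(x,y)^\eta$; $C^\eta(\Lambda)$ is the space of functions $g:\Lambda\to\mathbb{R}$ with $\|g\|_\eta<\infty$. *)

theory Defs
  imports "HOL-Probability.Probability"
begin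

definition measure_preserving_semiflow ::
    "'a measure \<Rightarrow> (real \<Rightarrow> 'a \<Rightarrow> 'a) \<Rightarrow> bool" where
  "measure_preserving_semiflow M F \<longleftrightarrow>
     (\<forall>x. F 0 x = x) \<and>
     (\<forall>s\<ge>0. \<forall>t\<ge>0. \<forall>x. F (s + t) x = F s (F t x)) \<and>
     (\<forall>t\<ge>0. F t \<in> measurable M M \<and> distr M M (F t) = M)"

text \<open>\<open>esssup\<close> is the top element on non-measurable functions. It is taken over the completion so
  that functions which are only almost everywhere equal to a Borel function, such as the time
  integrals \<open>flow_integral\<close> below, have their usual essential supremum.\<close>

definition Linf_norm :: "'a measure \<Rightarrow> ('a \<Rightarrow> real) \<Rightarrow> ennreal" where
  "Linf_norm M g = esssup (completion M) (\<lambda>x. ennreal \<bar>g x\<bar>)"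

definition Linf_space :: "'a measure \<Rightarrow> ('a \<Rightarrow> real) set" where
  "Linf_space M = {g \<in> borel_measurable M. Linf_norm M g < \<infinity>}"

text \<open>The target \<open>ennreal\<close> makes the supremum over the empty set (one-point spaces) zero.\<close>

definition holder_norm :: "'a::metric_space measure \<Rightarrow> real \<Rightarrow> ('a \<Rightarrow> real) \<Rightarrow> ennreal" where
  "holder_norm M \<eta> g = Linf_norm M g +
     (SUP (x, y)\<in>{(x, y). x \<noteq> y}. ennreal (\<bar>g x - g y\<bar> / dist x y powr \<eta>))"

definition holder_space :: "'a::metric_space measure \<Rightarrow> real \<Rightarrow> ('a \<Rightarrow> real) set" where
  "holder_space M \<eta> = {g. holder_norm M \<eta> g < \<infinity>}"

text \<open>Elements of \<open>L\<^sup>1\<close> are represented by integrable functions, so the operator below picks a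
  representative of each value. Its values are determined almost everywhere.\<close>

definition transfer_operator ::
    "'a measure \<Rightarrow> ('a \<Rightarrow> 'a) \<Rightarrow> (('a \<Rightarrow> real) \<Rightarrow> ('a \<Rightarrow> real)) \<Rightarrow> bool" where
  "transfer_operator M T P \<longleftrightarrow>
     (\<forall>v. integrable M v \<longrightarrow> integrable M (P v) \<and>
        (\<forall>w\<in>Linf_space M. (\<integral>x. P v x * w x \<partial>M) = (\<integral>x. v x * w (T x) \<partial>M)))"

definition flow_integral ::
    "(real \<Rightarrow> 'a \<Rightarrow> 'a) \<Rightarrow> ('a \<Rightarrow> real) \<Rightarrow> real \<Rightarrow> 'a \<Rightarrow> real" where
  "flow_integral F v t x = (LBINT r:{0..t}. v (F r x))"

text \<open>The integral \<open>chi = \<integral> f t \<partial>N\<close> of a family of elements of \<open>L\<^sup>1(M)\<close>. Each \<open>f t\<close> matters only up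
  to an \<open>M\<close>-null set depending on \<open>t\<close>, so the sections \<open>t \<mapsto> f t x\<close> of arbitrary representatives need
  not be measurable. As usual, the integral over \<open>t\<close> for fixed \<open>x\<close> is therefore that of a jointly
  measurable version \<open>u\<close>. By Fubini the resulting \<open>chi\<close> is unique almost everywhere (for
  sigma-finite \<open>M\<close> and \<open>N\<close>).\<close>

definition has_L1_integral ::
    "'t measure \<Rightarrow> 'a measure \<Rightarrow> ('t \<Rightarrow> 'a \<Rightarrow> real) \<Rightarrow> ('a \<Rightarrow> real) \<Rightarrow> bool" where
  "has_L1_integral N M f chi \<longleftrightarrow>
     (\<exists>u. integrable (N \<Otimes>\<^sub>M M) (\<lambda>(t, x). u t x) \<and>
          (AE t in N. AE x in M. u t x = f t x) \<and>
          (AE x in M. chi x = (\<integral>t. u t x \<partial>N)))"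

end

theory Submission
  imports Defs
begin

text \<open>The integral \<open>\<chi>\<close> of \<open>L\<^sub>t v\<close> over \<open>t > 0\<close> solves the coboundary equation up to the defect
\<open>d\<^sub>t = v\<^sub>t - \<chi> \<circ> F\<^sub>t + \<chi>\<close>, and the transfer operator kills the defect. Indeed, writing
\<open>c(s) = \<integral> v (w \<circ> F\<^sub>s) d\<mu>\<close> for a bounded test function \<open>w\<close>, the three terms of \<open>d\<^sub>t\<close> integrate against
\<open>w \<circ> F\<^sub>t\<close> to plus, minus and plus the integrals of \<open>c\<close> over \<open>(0,t]\<close>, over \<open>(0,\<infinity>)\<close> and over \<open>(t,\<infinity>)\<close>, so that
\<open>\<integral> d\<^sub>t (w \<circ> F\<^sub>t) d\<mu> = 0\<close> (lemma \<open>defect_orthogonal\<close>). As \<open>d\<close> is also a cocycle,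
\<open>d\<^bsub>s+t\<^esub> = d\<^sub>s + d\<^sub>t \<circ> F\<^sub>s\<close>, the increments of \<open>d\<close> over consecutive time intervals are orthogonal: \<open>d\<close> is
a reverse martingale with stationary increments, and its second moment is additive in time. Hence
\<open>\<integral> d\<^sub>t\<^sup>2 = n \<integral> d\<^bsub>t/n\<^esub>\<^sup>2\<close>, while along a Lipschitz path \<open>d\<^bsub>t/n\<^esub>\<close> is of order \<open>n\<^bsup>-\<eta>\<^esup>\<close>, because \<open>\<chi>\<close> is
\<open>\<eta>\<close>-Hoelder. Since \<open>2\<eta> > 1\<close>, letting \<open>n\<close> tend to infinity gives \<open>d\<^sub>t = 0\<close>.

The Lipschitz constant of the path of \<open>x\<close> may be a non-integrable function of \<open>x\<close>, so the second
moments are taken over the set \<open>A\<close> of points \<open>x\<close> for which \<open>t \<mapsto> \<chi> (F\<^sub>t x)\<close> is Hoelder with a fixed constant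
on the rational times. For rational \<open>s\<close> this set is mapped into itself by \<open>F\<^sub>s\<close> and, as \<open>F\<^sub>s\<close> preserves a finite measure, \<open>A\<close> and its preimage agree up to a
null set. The weight \<open>indicator A\<close> therefore passes through \<open>F\<^sub>s\<close>, and the additivity of the second
moment persists (lemma \<open>second_moment_add\<close>).

It remains to construct \<open>\<chi>\<close>. Each \<open>L\<^sub>t v\<close> is only given up to a null set depending on \<open>t\<close>, so neither the
measurability of \<open>t \<mapsto> L\<^sub>t v x\<close> nor a pointwise Hoelder estimate under the integral is available. Both
come from the strong continuity of \<open>L\<^sub>t\<close>: duality gives
\<open>\<parallel>L\<^bsub>s+h\<^esub> v - L\<^sub>s v\<parallel>\<^sub>1 \<le> \<parallel>v \<circ> F\<^sub>h - v\<parallel>\<^sub>1\<close>, and the right-hand side tends to zero with \<open>h\<close> because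
almost every path is continuous. Uniform continuity in \<open>L\<^sup>1\<close> yields a jointly measurable version of
\<open>(t, x) \<mapsto> L\<^sub>t v x\<close>, and it makes Riemann sums converge to \<open>\<chi>\<close> in \<open>L\<^sup>1\<close>. If the nodes are chosen where the
Hoelder norm is below its mean over the cell, then every Riemann sum is Hoelder with constant at most
\<open>\<integral> \<parallel>L\<^sub>t v\<parallel>\<^sub>\<eta> dt\<close>, everywhere on the space, and so is the upper limit of an almost everywhere convergent
sequence of them.\<close>

section \<open>Integrals of \<open>L\<^sup>1\<close>-continuous families\<close>

definition L1_uniformly_continuous :: "'a measure \<Rightarrow> (real \<Rightarrow> 'a \<Rightarrow> real) \<Rightarrow> bool" where
  "L1_uniformly_continuous M f \<longleftrightarrow>
     (\<forall>t>0. integrable M (f t)) \<and>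
     (\<forall>e>0. \<exists>d>0. \<forall>s>0. \<forall>t>0. \<bar>s - t\<bar> \<le> d \<longrightarrow> (\<integral>x. \<bar>f s x - f t x\<bar> \<partial>M) \<le> e)"

text \<open>The sum of the functions \<open>\<bar>g k\<bar>\<close> has finite integral, so it converges almost everywhere and its terms
tend to zero. A geometric rate thus turns \<open>L\<^sup>1\<close> convergence into convergence almost everywhere without
passing to a subsequence.\<close>

lemma AE_tendsto_0_of_geometric_L1_bound:
  fixes g :: "nat \<Rightarrow> 'a \<Rightarrow> real"
  assumes [measurable]: "\<And>k. integrable M (g k)"
    and bound: "\<And>k. (\<integral>x. \<bar>g k x\<bar> \<partial>M) \<le> (1/2)^k"
  shows "AE x in M. (\<lambda>k. g k x) \<longlonglongrightarrow> 0"
proof -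
  have "(\<integral>\<^sup>+x. (\<Sum>k. ennreal \<bar>g k x\<bar>) \<partial>M) = (\<Sum>k. \<integral>\<^sup>+x. ennreal \<bar>g k x\<bar> \<partial>M)"
    by (intro nn_integral_suminf) auto
  also have "\<dots> \<le> (\<Sum>k. ennreal ((1/2)^k))"
  proof (intro suminf_le allI)
    fix k
    have "(\<integral>\<^sup>+x. ennreal \<bar>g k x\<bar> \<partial>M) = ennreal (\<integral>x. \<bar>g k x\<bar> \<partial>M)"
      by (intro nn_integral_eq_integral) (auto simp: assms(1))
    then show "(\<integral>\<^sup>+x. ennreal \<bar>g k x\<bar> \<partial>M) \<le> ennreal ((1/2)^k)"
      using bound[of k] by (simp add: ennreal_leI)
  qed auto
  also have "\<dots> = ennreal (\<Sum>k. (1/2)^k)"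
    by (intro suminf_ennreal2) (auto intro: summable_geometric)
  also have "\<dots> < \<infinity>" by simp
  finally have "AE x in M. (\<Sum>k. ennreal \<bar>g k x\<bar>) \<noteq> \<infinity>"
    by (intro nn_integral_PInf_AE) auto
  then show ?thesis
  proof eventually_elim
    case (elim x)
    then have "summable (\<lambda>k. \<bar>g k x\<bar>)"
      by (intro summable_suminf_not_top) auto
    then show ?case
      using summable_LIMSEQ_zero tendsto_rabs_zero_iff by blast
  qed
qed

text \<open>Sampling the family on a fine grid gives a function that is a countable case distinction in \<open>t\<close>,
hence jointly measurable. If the mesh of the \<open>k\<close>-th grid is chosen such that the sampling error is at
most \<open>(1/2)^k\<close> in \<open>L\<^sup>1\<close>, then for every \<open>t\<close> the samples converge almost everywhere, and their limit is
jointly measurable as well.\<close>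

lemma L1_uniformly_continuous_measurable_version:
  assumes f: "L1_uniformly_continuous M f"
  obtains u where "case_prod u \<in> borel_measurable (borel \<Otimes>\<^sub>M M)"
    "\<And>t. t > 0 \<Longrightarrow> AE x in M. u t x = f t x"
proof -
  have int[measurable]: "integrable M (f t)" if "t > 0" for t
    using f that by (auto simp: L1_uniformly_continuous_def)
  have "\<exists>n::nat. n > 0 \<and> (\<forall>s>0. \<forall>t>0. \<bar>s - t\<bar> \<le> 1 / real n \<longrightarrow> (\<integral>x. \<bar>f s x - f t x\<bar> \<partial>M) \<le> (1/2)^k)" for k :: nat
  proof -
    obtain d :: real where d: "d > 0" "\<forall>s>0. \<forall>t>0. \<bar>s - t\<bar> \<le> d \<longrightarrow> (\<integral>x. \<bar>f s x - f t x\<bar> \<partial>M) \<le> (1/2)^k"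
      using f unfolding L1_uniformly_continuous_def by (metis zero_less_power zero_less_divide_1_iff zero_less_numeral)
    obtain n :: nat where "n > 0" "1 / n < d"
      using d(1) by (metis nat_approx_posE of_nat_Suc zero_less_Suc)
    moreover from this have "\<bar>s - t\<bar> \<le> d" if "\<bar>s - t\<bar> \<le> 1 / n" for s t :: real
      using that by linarith
    ultimately show ?thesis using d(2) by (intro exI[of _ n]) simp
  qed
  then obtain n :: "nat \<Rightarrow> nat" where n: "\<And>k. n k > 0"
    "\<And>k s t. s > 0 \<Longrightarrow> t > 0 \<Longrightarrow> \<bar>s - t\<bar> \<le> 1 / n k \<Longrightarrow> (\<integral>x. \<bar>f s x - f t x\<bar> \<partial>M) \<le> (1/2)^k"
    by metis
  \<comment> \<open>The grid point above \<open>t\<close>; the successor keeps it positive.\<close>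
  define \<tau> where "\<tau> k i = real (Suc i) / n k" for k i
  define I where "I k t = nat \<lfloor>t * n k\<rfloor>" for k and t :: real
  define u where "u t x = lim (\<lambda>k. f (\<tau> k (I k t)) x)" for t x
  have \<tau>_pos: "\<tau> k i > 0" for k i using n(1)[of k] by (simp add: \<tau>_def)
  have "(\<lambda>p. f (\<tau> k (I k (fst p))) (snd p)) \<in> borel_measurable (borel \<Otimes>\<^sub>M M)" for k
  proof (rule measurable_compose_countable[where f="\<lambda>i p. f (\<tau> k i) (snd p)"])
    show "(\<lambda>p. f (\<tau> k i) (snd p)) \<in> borel_measurable (borel \<Otimes>\<^sub>M M)" for i
      using borel_measurable_integrable[OF int[OF \<tau>_pos[of k i]]] by measurable
    show "(\<lambda>p. I k (fst p)) \<in> borel \<Otimes>\<^sub>M M \<rightarrow>\<^sub>M count_space UNIV"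
      unfolding I_def by measurable
  qed
  then have "(\<lambda>p. u (fst p) (snd p)) \<in> borel_measurable (borel \<Otimes>\<^sub>M M)"
    unfolding u_def by (rule borel_measurable_lim_metric)
  moreover have "AE x in M. u t x = f t x" if t: "t > 0" for t
  proof -
    have *: "\<bar>\<tau> k (I k t) - t\<bar> \<le> 1 / n k" for k
    proof -
      have "real (I k t) = of_int \<lfloor>t * n k\<rfloor>" using t by (simp add: I_def)
      then have "real (I k t) \<le> t * n k" "t * n k < real (I k t) + 1" by linarith+
      then show ?thesis using n(1)[of k] by (simp add: \<tau>_def abs_le_iff field_simps)
    qed
    have "AE x in M. (\<lambda>k. f (\<tau> k (I k t)) x - f t x) \<longlonglongrightarrow> 0"
      by (intro AE_tendsto_0_of_geometric_L1_bound n(2) * Bochner_Integration.integrable_diff int \<tau>_pos t)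
    then show ?thesis
      by eventually_elim (auto simp: u_def LIM_zero_iff intro!: limI)
  qed
  ultimately show ?thesis by (intro that) (auto simp: case_prod_beta')
qed

text \<open>A function cannot exceed its mean almost everywhere. The predicate \<open>P\<close> allows the point to be
chosen outside a null set.\<close>

lemma exists_point_below_mean:
  fixes H :: "real \<Rightarrow> real"
  assumes H: "set_integrable lborel {a<..b} H" and "a < b"
    and P: "AE t in lborel. t \<in> {a<..b} \<longrightarrow> P t"
  shows "\<exists>t\<in>{a<..b}. P t \<and> (b - a) * H t \<le> (LBINT t:{a<..b}. H t)"
proof (rule ccontr)
  assume contra: "\<not> ?thesis"
  define c where "c = (LBINT t:{a<..b}. H t) / (b - a)"
  define g where "g t = indicator {a<..b} t *\<^sub>R H t - indicator {a<..b} t *\<^sub>R c" for t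
  have above: "c < H t" if "t \<in> {a<..b}" "P t" for t
    using contra that \<open>a < b\<close> by (auto simp: c_def field_simps)
  have intc: "integrable lborel (\<lambda>t. indicator {a<..b} t *\<^sub>R c)"
    using \<open>a < b\<close> by (intro integrable_scaleR_left integrable_real_indicator) auto
  have g: "integrable lborel g" unfolding g_def
    using H intc by (intro Bochner_Integration.integrable_diff) (auto simp: set_integrable_def)
  have "integral\<^sup>L lborel g = (LBINT t:{a<..b}. H t) - (b - a) * c"
    unfolding g_def using H intc \<open>a < b\<close>
    by (subst Bochner_Integration.integral_diff) (auto simp: set_integrable_def set_lebesgue_integral_def)
  then have "integral\<^sup>L lborel g = 0" using \<open>a < b\<close> by (simp add: c_def)
  moreover have "AE t in lborel. 0 \<le> g t"
    using P
  proof eventually_elim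
    case (elim t)
    then show ?case using above[of t] by (auto simp: g_def indicator_def)
  qed
  ultimately have "AE t in lborel. g t = 0"
    using integral_nonneg_eq_0_iff_AE[OF g] by simp
  then have "AE t in lborel. t \<notin> {a<..b}"
    using P
  proof eventually_elim
    case (elim t)
    then show ?case using above[of t] by (auto simp: g_def indicator_def)
  qed
  then have "emeasure lborel {a<..b} = 0"
    by (subst (asm) AE_iff_measurable[OF _ refl]) (auto simp: Collect_neg_eq greaterThanAtMost_def Int_def)
  then show False using \<open>a < b\<close> by simp
qed

abbreviation lborel_pos :: "real measure" where
  "lborel_pos \<equiv> restrict_space lborel {0<..}"

lemma sigma_finite_lborel_pos: "sigma_finite_measure lborel_pos"
  by (intro sigma_finite_measure_restrict_space) (auto intro: lborel.sigma_finite_measure_axioms)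

lemma measurable_lborel_pos_pair:
  "case_prod u \<in> borel_measurable (borel \<Otimes>\<^sub>M M) \<Longrightarrow> case_prod u \<in> borel_measurable (lborel_pos \<Otimes>\<^sub>M M)"
proof -
  assume u: "case_prod u \<in> borel_measurable (borel \<Otimes>\<^sub>M M)"
  have "fst \<in> lborel_pos \<Otimes>\<^sub>M M \<rightarrow>\<^sub>M borel"
    by (rule measurable_compose[OF measurable_fst measurable_restrict_space1]) simp
  from measurable_compose[OF measurable_Pair[OF this measurable_snd] u] show ?thesis by (simp add: case_prod_beta')
qed

text \<open>On a probability space the bound \<open>H t\<close> on the function \<open>f t\<close> also bounds its \<open>L\<^sup>1\<close> norm, so Tonelli's
theorem applies to the jointly measurable version \<open>u\<close>.\<close>

lemma (in prob_space) integrable_measurable_version: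
  fixes f u :: "real \<Rightarrow> 'a \<Rightarrow> real" and H :: "real \<Rightarrow> real"
  assumes f: "\<And>t. t > 0 \<Longrightarrow> integrable M (f t)"
    and u: "case_prod u \<in> borel_measurable (borel \<Otimes>\<^sub>M M)" "\<And>t. t > 0 \<Longrightarrow> AE x in M. u t x = f t x"
    and H: "set_integrable lborel {0<..} H"
    and bound: "AE t in lborel. t > 0 \<longrightarrow> (AE x in M. \<bar>f t x\<bar> \<le> H t)"
  shows "integrable (lborel_pos \<Otimes>\<^sub>M M) (case_prod u)"
    and "AE t in lborel_pos. (\<integral>x. \<bar>u t x\<bar> \<partial>M) \<le> H t"
proof -
  interpret N: sigma_finite_measure lborel_pos by (rule sigma_finite_lborel_pos)
  interpret pair_sigma_finite lborel_pos M ..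
  note [measurable] = measurable_lborel_pos_pair[OF u(1)]
  have int: "integrable M (u t)" if "t > 0" for t
  proof -
    have [measurable]: "u t \<in> borel_measurable M" using u(1) by measurable
    show ?thesis using integrable_cong_AE[OF _ _ u(2)[OF that]] f[OF that] by auto
  qed
  have "AE t in lborel_pos. (AE x in M. \<bar>f t x\<bar> \<le> H t) \<and> t > 0"
    using bound by (subst AE_restrict_space_iff) auto
  then show le: "AE t in lborel_pos. (\<integral>x. \<bar>u t x\<bar> \<partial>M) \<le> H t"
  proof eventually_elim
    case (elim t)
    have "(\<integral>x. \<bar>u t x\<bar> \<partial>M) \<le> (\<integral>x. H t \<partial>M)"
    proof (rule Bochner_Integration.integral_mono_AE)
      show "AE x in M. \<bar>u t x\<bar> \<le> H t" using u(2)[of t] elim by auto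
    qed (use elim int in auto)
    then show ?case by (simp add: prob_space)
  qed
  show "integrable (lborel_pos \<Otimes>\<^sub>M M) (case_prod u)"
  proof (rule Fubini_integrable)
    have H': "integrable lborel_pos H"
      using H by (subst integrable_restrict_space) (auto simp: set_integrable_def)
    show "integrable lborel_pos (\<lambda>t. \<integral>x. norm (case (t, x) of (t, x) \<Rightarrow> u t x) \<partial>M)"
      by (rule Bochner_Integration.integrable_bound[OF H']) (use le in \<open>auto elim!: eventually_mono\<close>)
    show "AE t in lborel_pos. integrable M (\<lambda>x. case (t, x) of (t, x) \<Rightarrow> u t x)"
      using int by (subst AE_restrict_space_iff) auto
  qed auto
qed

lemma small_tail_integral:
  fixes H :: "real \<Rightarrow> real"
  assumes H: "set_integrable lborel {0<..} H" and "e > 0"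
  shows "\<exists>m::nat. m > 0 \<and> (LBINT t:{real m<..}. H t) \<le> e"
proof -
  have "(\<lambda>m::nat. \<integral>t. indicator {real m<..} t *\<^sub>R H t \<partial>lborel) \<longlonglongrightarrow> (\<integral>t. 0 \<partial>(lborel::real measure))"
  proof (rule integral_dominated_convergence[where w="\<lambda>t. norm (indicator {0<..} t *\<^sub>R H t)"])
    have [measurable]: "integrable lborel (\<lambda>t. indicator {0<..} t *\<^sub>R H t)"
      using H by (simp add: set_integrable_def)
    then show "integrable lborel (\<lambda>t. norm (indicator {0<..} t *\<^sub>R H t))"
      by (rule Bochner_Integration.integrable_norm)
    fix m :: nat
    have "(\<lambda>t. indicator {real m<..} t *\<^sub>R (indicator {0<..} t *\<^sub>R H t)) \<in> borel_measurable lborel"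
      by measurable
    also have "(\<lambda>t. indicator {real m<..} t *\<^sub>R (indicator {0<..} t *\<^sub>R H t)) = (\<lambda>t. indicator {real m<..} t *\<^sub>R H t)"
      by (auto simp: indicator_def)
    finally show "(\<lambda>t. indicator {real m<..} t *\<^sub>R H t) \<in> borel_measurable lborel" .
    show "AE t in lborel. (\<lambda>m. indicator {real m<..} t *\<^sub>R H t) \<longlonglongrightarrow> 0"
    proof (intro AE_I2)
      fix t :: real
      obtain k :: nat where "t \<le> k" using real_arch_simple by blast
      then have "eventually (\<lambda>m. indicator {real m<..} t *\<^sub>R H t = 0) sequentially"
        by (intro eventually_sequentiallyI[of k]) auto
      then show "(\<lambda>m. indicator {real m<..} t *\<^sub>R H t) \<longlonglongrightarrow> 0" by (rule tendsto_eventually)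
    qed
    show "AE t in lborel. norm (indicator {real m<..} t *\<^sub>R H t) \<le> norm (indicator {0<..} t *\<^sub>R H t)"
      by (auto simp: indicator_def)
    show "(\<lambda>t. 0) \<in> borel_measurable lborel" by simp
  qed
  then have "eventually (\<lambda>m::nat. (\<integral>t. indicator {real m<..} t *\<^sub>R H t \<partial>lborel) < e) sequentially"
    using \<open>e > 0\<close> by (auto dest: order_tendstoD(2)[of _ _ _ e])
  then obtain k :: nat where "\<And>m. m \<ge> k \<Longrightarrow> (\<integral>t. indicator {real m<..} t *\<^sub>R H t \<partial>lborel) < e"
    by (auto simp: eventually_sequentially)
  then show ?thesis
    by (intro exI[of _ "Suc k"]) (auto simp: set_lebesgue_integral_def simp del: of_nat_Suc intro: less_imp_le)
qed

lemma sum_set_integral_grid: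
  fixes H :: "real \<Rightarrow> real" and \<delta> :: real
  assumes "set_integrable lborel {0<..} H" and "\<delta> \<ge> 0"
  shows "(\<Sum>i<k. LBINT t:{i * \<delta><..Suc i * \<delta>}. H t) = (LBINT t:{0<..real k * \<delta>}. H t)"
proof (induction k)
  case (Suc k)
  have sub: "set_integrable lborel A H" if "A \<in> sets borel" "A \<subseteq> {0<..}" for A
    using that by (intro set_integrable_subset[OF assms(1)]) auto
  have "0 \<le> real k * \<delta>" "real k * \<delta> \<le> real (Suc k) * \<delta>"
    using assms(2) by (auto intro: mult_right_mono)
  then have "{0<..real (Suc k) * \<delta>} = {0<..real k * \<delta>} \<union> {real k * \<delta><..real (Suc k) * \<delta>}"
    by auto
  moreover have "(LBINT t:{0<..real k * \<delta>} \<union> {real k * \<delta><..real (Suc k) * \<delta>}. H t) =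
      (LBINT t:{0<..real k * \<delta>}. H t) + (LBINT t:{real k * \<delta><..real (Suc k) * \<delta>}. H t)"
    using assms(2) by (intro set_integral_Un sub) (auto simp: zero_le_mult_iff intro: le_less_trans[rotated])
  ultimately show ?case using Suc by simp
qed (simp add: set_lebesgue_integral_def)

lemma L1_uniformly_continuousE:
  assumes f: "L1_uniformly_continuous M f" and "e > 0"
  obtains d where "d > 0"
    "\<And>s t. s > 0 \<Longrightarrow> t > 0 \<Longrightarrow> \<bar>s - t\<bar> \<le> d \<Longrightarrow> (\<integral>x. \<bar>f s x - f t x\<bar> \<partial>M) \<le> e"
proof -
  have "\<exists>d>0. \<forall>s>0. \<forall>t>0. \<bar>s - t\<bar> \<le> d \<longrightarrow> (\<integral>x. \<bar>f s x - f t x\<bar> \<partial>M) \<le> e"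
    using f[unfolded L1_uniformly_continuous_def, THEN conjunct2, THEN spec, THEN mp, OF \<open>e > 0\<close>] .
  then show ?thesis using that by (elim exE conjE) simp
qed

text \<open>The integral of the family \<open>f\<close> is approximated in \<open>L\<^sup>1\<close> by Riemann sums that inherit the pointwise bounds
of the family with the constant \<open>\<integral> H\<close>. The family may be badly behaved on a null set of times and \<open>H\<close>
may be unbounded, so the node in each cell \<open>A i\<close> of the grid is taken at a time where the bounds
hold and \<open>H\<close> is at most its mean over the cell. Then the sum of the weights \<open>\<delta> * H (\<tau> i)\<close> is at most
\<open>\<integral> H\<close>. The error splits into the oscillation of \<open>f\<close> within the cells up to a time \<open>m\<close>, controlled by
uniform continuity in \<open>L\<^sup>1\<close>, and the tail of \<open>H\<close> beyond \<open>m\<close>. The function \<open>\<rho>\<close> stands for a power of the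
distance.\<close>

lemma (in prob_space) L1_Riemann_sum_approximation:
  fixes f u :: "real \<Rightarrow> 'a \<Rightarrow> real" and H :: "real \<Rightarrow> real" and \<rho> :: "'a \<Rightarrow> 'a \<Rightarrow> real"
  assumes f: "L1_uniformly_continuous M f"
    and u: "case_prod u \<in> borel_measurable (borel \<Otimes>\<^sub>M M)" "\<And>t. t > 0 \<Longrightarrow> AE x in M. u t x = f t x"
    and H: "set_integrable lborel {0<..} H" "\<And>t. t > 0 \<Longrightarrow> 0 \<le> H t"
    and \<rho>: "\<And>x y. 0 \<le> \<rho> x y"
    and bound: "AE t in lborel. t > 0 \<longrightarrow>
        (AE x in M. \<bar>f t x\<bar> \<le> H t) \<and> (\<forall>x y. \<bar>f t x - f t y\<bar> \<le> H t * \<rho> x y)"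
    and "e > 0"
  shows "\<exists>S. integrable M S \<and> (AE x in M. \<bar>S x\<bar> \<le> (LBINT t:{0<..}. H t)) \<and>
      (\<forall>x y. \<bar>S x - S y\<bar> \<le> (LBINT t:{0<..}. H t) * \<rho> x y) \<and>
      (\<integral>x. \<bar>S x - (\<integral>t. u t x \<partial>lborel_pos)\<bar> \<partial>M) \<le> e"
proof -
  interpret N: sigma_finite_measure lborel_pos by (rule sigma_finite_lborel_pos)
  interpret pair_sigma_finite lborel_pos M ..
  have fint: "integrable M (f t)" if "t > 0" for t
    using f that by (auto simp: L1_uniformly_continuous_def)
  have uint: "integrable (lborel_pos \<Otimes>\<^sub>M M) (case_prod u)"
    and ule: "AE t in lborel_pos. (\<integral>x. \<bar>u t x\<bar> \<partial>M) \<le> H t"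
    using integrable_measurable_version[OF fint u H(1) eventually_mono[OF bound]] by auto
  define J where "J = (LBINT t:{0<..}. H t)"
  obtain m :: nat where m: "m > 0" "(LBINT t:{real m<..}. H t) \<le> e / 2"
    using small_tail_integral[OF H(1), of "e / 2"] \<open>e > 0\<close> by auto
  obtain d :: real where d: "d > 0"
    "\<And>s t. s > 0 \<Longrightarrow> t > 0 \<Longrightarrow> \<bar>s - t\<bar> \<le> d \<Longrightarrow> (\<integral>x. \<bar>f s x - f t x\<bar> \<partial>M) \<le> e / (2 * m)"
  proof -
    have "e / (2 * m) > 0" using \<open>e > 0\<close> m(1) by simp
    from L1_uniformly_continuousE[OF f this] show ?thesis using that by blast
  qed
  obtain n :: nat where n: "n > 0" "1 / real n < d"
    using d(1) by (metis nat_approx_posE of_nat_Suc zero_less_Suc)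
  define \<delta> where "\<delta> = 1 / real n"
  have \<delta>: "\<delta> > 0" "\<delta> < d" using n by (auto simp: \<delta>_def)
  define A where "A i = {real i * \<delta><..real (Suc i) * \<delta>}" for i
  have A_pos: "A i \<subseteq> {0<..}" for i
    using \<delta> by (auto simp: A_def intro: le_less_trans[rotated])
  have A_meas[measurable]: "A i \<in> sets borel" for i by (simp add: A_def)
  have HA: "set_integrable lborel B H" if "B \<in> sets borel" "B \<subseteq> {0<..}" for B
    using that by (intro set_integrable_subset[OF H(1)]) auto
  define good where "good t \<longleftrightarrow>
      (AE x in M. \<bar>f t x\<bar> \<le> H t) \<and> (\<forall>x y. \<bar>f t x - f t y\<bar> \<le> H t * \<rho> x y)" for t
  have "\<exists>t\<in>A i. good t \<and> \<delta> * H t \<le> (LBINT t:A i. H t)" for i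
  proof -
    have "real (Suc i) * \<delta> - real i * \<delta> = \<delta>" by (simp add: algebra_simps)
    moreover have "AE t in lborel. t \<in> A i \<longrightarrow> good t"
      using bound by eventually_elim (use A_pos[of i] in \<open>auto simp: good_def\<close>)
    moreover have "real i * \<delta> < real (Suc i) * \<delta>" using \<delta> by simp
    ultimately show ?thesis
      using exists_point_below_mean[OF HA[OF A_meas A_pos, of i, unfolded A_def], of good]
      by (simp add: A_def del: of_nat_Suc)
  qed
  then obtain \<tau> where \<tau>A: "\<And>i. \<tau> i \<in> A i"
    and \<tau>H: "\<And>i. \<delta> * H (\<tau> i) \<le> (LBINT t:A i. H t)"
    and \<tau>b': "\<And>i. good (\<tau> i)"
    by metis
  have \<tau>_pos: "\<tau> i > 0" for i using A_pos \<tau>A by auto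
  have \<tau>b: "AE x in M. \<bar>f (\<tau> i) x\<bar> \<le> H (\<tau> i)" "\<bar>f (\<tau> i) x - f (\<tau> i) y\<bar> \<le> H (\<tau> i) * \<rho> x y" for i x y
    using \<tau>b'[of i] by (auto simp: good_def)
  define K where "K = m * n"
  have K\<delta>: "real K * \<delta> = m" using n by (simp add: K_def \<delta>_def)
  have "(\<Sum>i<K. \<delta> * H (\<tau> i)) \<le> (\<Sum>i<K. LBINT t:A i. H t)"
    by (intro sum_mono \<tau>H)
  also have "\<dots> = (LBINT t:{0<..real m}. H t)"
    using sum_set_integral_grid[OF H(1), of \<delta> K] \<delta> K\<delta> by (simp add: A_def)
  also have "\<dots> \<le> J" unfolding J_def
    unfolding set_lebesgue_integral_def
  proof (rule integral_mono)
    show "integrable lborel (\<lambda>t. indicator {0<..real m} t *\<^sub>R H t)"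
      using HA[of "{0<..real m}"] by (simp add: set_integrable_def subset_eq)
    show "integrable lborel (\<lambda>t. indicator {0<..} t *\<^sub>R H t)"
      using H(1) by (simp add: set_integrable_def)
    show "indicator {0<..real m} t *\<^sub>R H t \<le> indicator {0<..} t *\<^sub>R H t" for t
      using H(2) by (auto simp: indicator_def)
  qed
  finally have sum_le: "(\<Sum>i<K. \<delta> * H (\<tau> i)) \<le> J" .

  \<comment> \<open>\<open>g\<close> is the step function in time whose integral is the Riemann sum \<open>S\<close>.\<close>
  define S where "S x = (\<Sum>i<K. \<delta> * f (\<tau> i) x)" for x
  define g where "g t x = (\<Sum>i<K. indicator (A i) t * f (\<tau> i) x)" for t x
  have Sint: "integrable M S"
    unfolding S_def by (intro Bochner_Integration.integrable_sum integrable_mult_right fint \<tau>_pos)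
  have "AE x in M. \<forall>i. \<bar>f (\<tau> i) x\<bar> \<le> H (\<tau> i)"
    using \<tau>b(1) by (simp add: AE_all_countable)
  then have S_bound: "AE x in M. \<bar>S x\<bar> \<le> J"
  proof eventually_elim
    case (elim x)
    have "\<bar>S x\<bar> \<le> (\<Sum>i<K. \<bar>\<delta> * f (\<tau> i) x\<bar>)" unfolding S_def by (rule sum_abs)
    also have "\<dots> \<le> (\<Sum>i<K. \<delta> * H (\<tau> i))"
      using elim \<delta> by (intro sum_mono) (auto simp: abs_mult)
    finally show ?case using sum_le by simp
  qed
  have S_mod: "\<bar>S x - S y\<bar> \<le> J * \<rho> x y" for x y
  proof -
    have "\<bar>S x - S y\<bar> = \<bar>\<Sum>i<K. \<delta> * (f (\<tau> i) x - f (\<tau> i) y)\<bar>"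
      by (simp add: S_def sum_subtractf right_diff_distrib)
    also have "\<dots> \<le> (\<Sum>i<K. \<bar>\<delta> * (f (\<tau> i) x - f (\<tau> i) y)\<bar>)" by (rule sum_abs)
    also have "\<dots> \<le> (\<Sum>i<K. \<delta> * H (\<tau> i) * \<rho> x y)"
      using \<tau>b(2) \<delta> by (intro sum_mono) (auto simp: abs_mult mult.assoc)
    also have "\<dots> = (\<Sum>i<K. \<delta> * H (\<tau> i)) * \<rho> x y" by (simp add: sum_distrib_right)
    also have "\<dots> \<le> J * \<rho> x y" by (intro mult_right_mono sum_le \<rho>)
    finally show ?thesis .
  qed

  have ind_int: "integrable lborel_pos (\<lambda>t. indicator (A i) t :: real)" for i
  proof -
    have "integrable lborel (\<lambda>t. indicator (A i) t :: real)"
      using \<delta> by (intro integrable_real_indicator) (auto simp: A_def)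
    also have "(\<lambda>t. indicator (A i) t :: real) = (\<lambda>t. indicator {0<..} t *\<^sub>R indicator (A i) t)"
      using A_pos[of i] by (auto simp: fun_eq_iff indicator_def)
    finally show ?thesis by (subst integrable_restrict_space) auto
  qed
  have ind_val: "(\<integral>t. indicator (A i) t \<partial>lborel_pos) = \<delta>" for i
  proof -
    have "(\<integral>t. indicator (A i) t \<partial>lborel_pos) = (\<integral>t. indicator (A i) t \<partial>lborel :: real)"
    proof -
      have "(\<integral>t. indicator (A i) t \<partial>lborel_pos) = (\<integral>t. indicator {0<..} t *\<^sub>R indicator (A i) t \<partial>lborel :: real)"
        by (rule integral_restrict_space) simp
      also have "(\<lambda>t. indicator {0<..} t *\<^sub>R indicator (A i) t) = (\<lambda>t. indicator (A i) t :: real)"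
        using A_pos[of i] by (auto simp: fun_eq_iff indicator_def)
      finally show ?thesis .
    qed
    also have "\<dots> = real (Suc i) * \<delta> - real i * \<delta>"
      using \<delta> by (simp add: A_def)
    finally show ?thesis by (simp add: algebra_simps)
  qed
  have gint: "integrable (lborel_pos \<Otimes>\<^sub>M M) (case_prod g)"
  proof -
    have "integrable (lborel_pos \<Otimes>\<^sub>M M) (\<lambda>p. indicator (A i) (fst p) * f (\<tau> i) (snd p))" for i
    proof (rule Fubini_integrable)
      have [measurable]: "(\<lambda>t. indicator (A i) t :: real) \<in> borel_measurable lborel_pos"
        using ind_int by auto
      have [measurable]: "f (\<tau> i) \<in> borel_measurable M" using fint[OF \<tau>_pos] by auto
      show "(\<lambda>p. indicator (A i) (fst p) * f (\<tau> i) (snd p)) \<in> borel_measurable (lborel_pos \<Otimes>\<^sub>M M)"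
        by measurable
      show "integrable lborel_pos (\<lambda>t. \<integral>x. norm (indicator (A i) (fst (t, x)) * f (\<tau> i) (snd (t, x))) \<partial>M)"
        using ind_int by (simp add: abs_mult)
    qed (use fint[OF \<tau>_pos] in auto)
    then show ?thesis
      unfolding g_def case_prod_beta' by (intro Bochner_Integration.integrable_sum) auto
  qed
  have S_eq: "S x = (\<integral>t. g t x \<partial>lborel_pos)" for x
  proof -
    have "(\<integral>t. g t x \<partial>lborel_pos) = (\<Sum>i<K. \<integral>t. indicator (A i) t * f (\<tau> i) x \<partial>lborel_pos)"
      unfolding g_def by (intro Bochner_Integration.integral_sum integrable_mult_left ind_int)
    also have "\<dots> = S x"
      unfolding S_def by (intro sum.cong refl, subst integral_mult_left_zero, subst ind_val, rule refl)
    finally show ?thesis ..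
  qed
  define h where "h t x = g t x - u t x" for t x
  have hint: "integrable (lborel_pos \<Otimes>\<^sub>M M) (case_prod h)"
    using Bochner_Integration.integrable_diff[OF gint uint] by (simp add: h_def case_prod_beta')

  \<comment> \<open>A time \<open>t > 0\<close> lies in the cell with index \<open>\<lceil>t / \<delta>\<rceil> - 1\<close>, as cells are open on the left.\<close>
  have g_eq: "g t x = (if t \<le> m then f (\<tau> (nat \<lceil>t / \<delta>\<rceil> - 1)) x else 0)"
    and \<tau>_near: "\<bar>\<tau> (nat \<lceil>t / \<delta>\<rceil> - 1) - t\<bar> \<le> \<delta>"
    if "t > 0" for t x
  proof -
    define i where "i = nat \<lceil>t / \<delta>\<rceil> - 1"
    have "t / \<delta> > 0" using that \<delta> by simp
    then have "\<lceil>t / \<delta>\<rceil> \<ge> 1" by (simp add: one_le_ceiling)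
    then have "int i = \<lceil>t / \<delta>\<rceil> - 1" unfolding i_def by linarith
    then have "real i = of_int \<lceil>t / \<delta>\<rceil> - 1" by linarith
    then have "real i < t / \<delta>" "t / \<delta> \<le> real i + 1" by linarith+
    then have tA: "t \<in> A i" using \<delta> by (simp add: A_def field_simps)
    have uniq: "j = i" if "t \<in> A j" for j
    proof -
      have "real j * \<delta> < real (Suc i) * \<delta>" "real i * \<delta> < real (Suc j) * \<delta>"
        using that tA by (auto simp: A_def simp del: of_nat_Suc)
      then show ?thesis using \<delta>(1) by (simp del: of_nat_Suc)
    qed
    have "i < K \<longleftrightarrow> t \<le> m"
    proof
      assume "i < K"
      then have "real (Suc i) * \<delta> \<le> real K * \<delta>" using \<delta> by (intro mult_right_mono) auto
      then show "t \<le> m" using tA K\<delta> by (auto simp: A_def)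
    next
      assume "t \<le> m"
      then have "real i * \<delta> < real K * \<delta>" using tA K\<delta> by (auto simp: A_def)
      then show "i < K" using \<delta> by simp
    qed
    moreover have "g t x = (\<Sum>j<K. if j = i then f (\<tau> i) x else 0)"
    proof -
      have "t \<in> A j \<longleftrightarrow> j = i" for j using uniq tA by blast
      then show ?thesis unfolding g_def by (intro sum.cong refl) (simp add: indicator_def)
    qed
    ultimately show "g t x = (if t \<le> m then f (\<tau> (nat \<lceil>t / \<delta>\<rceil> - 1)) x else 0)"
      by (simp add: i_def)
    have "\<tau> i \<in> A i" by (rule \<tau>A)
    then show "\<bar>\<tau> (nat \<lceil>t / \<delta>\<rceil> - 1) - t\<bar> \<le> \<delta>"
      using tA unfolding A_def i_def[symmetric] by (simp add: abs_le_iff algebra_simps)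
  qed
  \<comment> \<open>\<open>c\<close> dominates the \<open>L\<^sup>1\<close> distance of the step function to \<open>u\<close> at time \<open>t\<close>; its integral is at most \<open>e\<close>.\<close>
  define c where "c t = indicator {0<..real m} t * (e / (2 * m)) + indicator {real m<..} t * H t" for t
  have "AE t in lborel_pos. t > 0" by (subst AE_restrict_space_iff) auto
  with ule have h_le: "AE t in lborel_pos. (\<integral>x. \<bar>h t x\<bar> \<partial>M) \<le> c t"
  proof eventually_elim
    case (elim t)
    have [measurable]: "u t \<in> borel_measurable M" using u(1) by measurable
    define s where "s = \<tau> (nat \<lceil>t / \<delta>\<rceil> - 1)"
    show ?case
    proof (cases "t \<le> m")
      case True
      have "(\<integral>x. \<bar>h t x\<bar> \<partial>M) = (\<integral>x. \<bar>f s x - f t x\<bar> \<partial>M)"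
      proof (rule integral_cong_AE)
        show "AE x in M. \<bar>h t x\<bar> = \<bar>f s x - f t x\<bar>"
          using u(2)[OF elim(2)] by eventually_elim (auto simp: h_def g_eq[OF elim(2)] True s_def)
        show "(\<lambda>x. \<bar>f s x - f t x\<bar>) \<in> borel_measurable M" "(\<lambda>x. \<bar>h t x\<bar>) \<in> borel_measurable M"
          using fint[OF \<tau>_pos] fint[OF elim(2)] \<open>u t \<in> borel_measurable M\<close>
          by (auto simp: h_def g_def s_def intro!: borel_measurable_diff borel_measurable_abs borel_measurable_sum borel_measurable_times)
      qed
      also have "\<dots> \<le> e / (2 * m)"
        using \<tau>_near[OF elim(2)] \<delta> elim(2) \<tau>_pos by (intro d(2)) (auto simp: s_def)
      finally show ?thesis using True elim(2) by (simp add: c_def)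
    next
      case False
      then show ?thesis using elim by (simp add: c_def h_def g_eq[OF elim(2)])
    qed
  qed
  have tail_int: "set_integrable lborel {real m<..} H"
    by (rule HA) auto
  have c1: "integrable lborel (\<lambda>t. indicator {0<..real m} t * (e / (2 * m)))"
    by (intro integrable_mult_left integrable_real_indicator) auto
  have c2: "integrable lborel (\<lambda>t. indicator {real m<..} t * H t)"
    using tail_int by (simp add: set_integrable_def)
  have cpos: "indicator {0<..} t *\<^sub>R c t = c t" for t by (auto simp: c_def indicator_def)
  have cint: "integrable lborel_pos c"
    using Bochner_Integration.integrable_add[OF c1 c2]
    by (subst integrable_restrict_space, simp, unfold cpos) (simp add: c_def[abs_def])
  have hxint: "AE x in M. integrable lborel_pos (\<lambda>t. g t x) \<and> integrable lborel_pos (\<lambda>t. u t x)"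
    using AE_integrable_snd[OF gint] AE_integrable_snd[OF uint] by eventually_elim auto
  have "(\<integral>x. \<bar>S x - (\<integral>t. u t x \<partial>lborel_pos)\<bar> \<partial>M) \<le> (\<integral>x. (\<integral>t. \<bar>h t x\<bar> \<partial>lborel_pos) \<partial>M)"
  proof (rule integral_mono_AE)
    have "integrable (lborel_pos \<Otimes>\<^sub>M M) (case_prod (\<lambda>t x. \<bar>h t x\<bar>))"
      using Bochner_Integration.integrable_abs[OF hint] by (simp add: case_prod_beta')
    from integrable_snd[OF this]
    show "integrable M (\<lambda>x. \<integral>t. \<bar>h t x\<bar> \<partial>lborel_pos)" .
    show "integrable M (\<lambda>x. \<bar>S x - (\<integral>t. u t x \<partial>lborel_pos)\<bar>)"
      using Sint integrable_snd[OF uint] by auto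
    show "AE x in M. \<bar>S x - (\<integral>t. u t x \<partial>lborel_pos)\<bar> \<le> (\<integral>t. \<bar>h t x\<bar> \<partial>lborel_pos)"
      using hxint
    proof eventually_elim
      case (elim x)
      then have "S x - (\<integral>t. u t x \<partial>lborel_pos) = (\<integral>t. h t x \<partial>lborel_pos)"
        by (simp add: S_eq h_def)
      then show ?case by simp
    qed
  qed
  also have "\<dots> = (\<integral>t. (\<integral>x. \<bar>h t x\<bar> \<partial>M) \<partial>lborel_pos)"
    using Bochner_Integration.integrable_abs[OF hint] by (intro Fubini_integral) (simp add: case_prod_beta')
  also have "\<dots> \<le> (\<integral>t. c t \<partial>lborel_pos)"
  proof (rule integral_mono_AE[OF _ cint h_le])
    have "integrable (lborel_pos \<Otimes>\<^sub>M M) (case_prod (\<lambda>t x. \<bar>h t x\<bar>))"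
      using Bochner_Integration.integrable_abs[OF hint] by (simp add: case_prod_beta')
    from integrable_fst[OF this]
    show "integrable lborel_pos (\<lambda>t. \<integral>x. \<bar>h t x\<bar> \<partial>M)" .
  qed
  also have "\<dots> = (\<integral>t. c t \<partial>lborel)"
    by (subst integral_restrict_space, simp, unfold cpos) (rule refl)
  also have "\<dots> = e / 2 + (LBINT t:{real m<..}. H t)"
    unfolding c_def using m(1)
    by (subst Bochner_Integration.integral_add[OF c1 c2]) (simp add: set_lebesgue_integral_def)
  also have "\<dots> \<le> e" using m(2) by simp
  finally show ?thesis
    using Sint S_bound S_mod unfolding J_def by blast
qed

text \<open>An upper limit of functions with a common modulus of continuity has the same modulus, at every
point and not just where the sequence converges. Convergence at the single point \<open>x0\<close> makes the sequence
bounded at all points, so that the upper limit is finite.\<close>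

lemma limsup_equicontinuous_family:
  fixes S :: "nat \<Rightarrow> 'a \<Rightarrow> real" and c :: "'a \<Rightarrow> 'a \<Rightarrow> real"
  assumes S: "\<And>k x y. \<bar>S k x - S k y\<bar> \<le> c x y" and x0: "convergent (\<lambda>k. S k x0)"
  defines "chi \<equiv> \<lambda>x. real_of_ereal (limsup (\<lambda>k. ereal (S k x)))"
  shows "\<bar>chi x - chi y\<bar> \<le> c x y"
proof -
  obtain B where B: "\<And>k. \<bar>S k x0\<bar> \<le> B"
    using x0 convergent_imp_Bseq by (force simp: Bseq_def)
  have fin: "ereal (chi z) = limsup (\<lambda>k. ereal (S k z))" for z
  proof -
    have *: "\<bar>S k z\<bar> \<le> B + c z x0" for k
      using B[of k] S[of k z x0] by linarith
    have "limsup (\<lambda>k. ereal (S k z)) \<le> ereal (B + c z x0)"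
      using * by (intro Limsup_bounded always_eventually) (auto simp: abs_le_iff)
    moreover have "ereal (- (B + c z x0)) \<le> liminf (\<lambda>k. ereal (S k z))"
    proof (intro Liminf_bounded always_eventually allI)
      show "ereal (- (B + c z x0)) \<le> ereal (S k z)" for k
        using *[of k] by (simp add: abs_le_iff)
    qed
    moreover have "liminf (\<lambda>k. ereal (S k z)) \<le> limsup (\<lambda>k. ereal (S k z))"
      by (intro Liminf_le_Limsup) simp
    ultimately show ?thesis
      unfolding chi_def by (cases "limsup (\<lambda>k. ereal (S k z))") auto
  qed
  have le: "chi y \<le> chi x + c' " if "\<And>k. \<bar>S k x - S k y\<bar> \<le> c'" for x y c'
  proof -
    have "ereal (chi y) \<le> limsup (\<lambda>k. ereal (S k x) + ereal c')"
      unfolding fin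
    proof (intro Limsup_mono always_eventually allI)
      show "ereal (S k y) \<le> ereal (S k x) + ereal c'" for k
        using that[of k] by simp
    qed
    also have "\<dots> = ereal (chi x + c')"
      by (subst Limsup_add_ereal_right) (auto simp: fin[symmetric])
    finally show ?thesis by simp
  qed
  have "\<bar>S k y - S k x\<bar> \<le> c x y" for k using S[of k x y] by (simp add: abs_minus_commute)
  then show ?thesis using le[of y x "c x y"] le[of x y "c x y"] S by (auto simp: abs_le_iff)
qed

text \<open>The approximations converge almost everywhere along a sequence, and the upper limit of this
sequence is a version of \<open>g\<close> which has the common modulus of continuity on the whole space.\<close>

lemma (in prob_space) modulus_version_of_L1_limit:
  fixes g :: "'a \<Rightarrow> real" and c :: "'a \<Rightarrow> 'a \<Rightarrow> real"
  assumes g: "integrable M g"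
    and approx: "\<And>e. e > 0 \<Longrightarrow> \<exists>S. integrable M S \<and> (AE x in M. \<bar>S x\<bar> \<le> J) \<and>
      (\<forall>x y. \<bar>S x - S y\<bar> \<le> c x y) \<and>
      (\<integral>x. \<bar>S x - g x\<bar> \<partial>M) \<le> e"
  shows "\<exists>chi. (\<forall>x y. \<bar>chi x - chi y\<bar> \<le> c x y) \<and>
      (AE x in M. \<bar>chi x\<bar> \<le> J) \<and> (AE x in M. chi x = g x)"
proof -
  define close where "close k S \<longleftrightarrow> integrable M S \<and> (AE x in M. \<bar>S x\<bar> \<le> J) \<and>
      (\<forall>x y. \<bar>S x - S y\<bar> \<le> c x y) \<and> (\<integral>x. \<bar>S x - g x\<bar> \<partial>M) \<le> (1/2)^k" for k :: nat and S
  have "\<exists>S. close k S" for k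
    using approx[of "(1/2)^k"] by (simp add: close_def)
  then obtain S where "\<And>k. close k (S k)"
    by metis
  then have S: "\<And>k. integrable M (S k)" "\<And>k. AE x in M. \<bar>S k x\<bar> \<le> J"
    "\<And>k x y. \<bar>S k x - S k y\<bar> \<le> c x y" "\<And>k. (\<integral>x. \<bar>S k x - g x\<bar> \<partial>M) \<le> (1/2)^k"
    by (simp_all add: close_def)
  have "AE x in M. (\<lambda>k. S k x - g x) \<longlonglongrightarrow> 0"
    by (intro AE_tendsto_0_of_geometric_L1_bound S Bochner_Integration.integrable_diff g)
  then have lim: "AE x in M. (\<lambda>k. S k x) \<longlonglongrightarrow> g x"
    by eventually_elim (simp add: LIM_zero_iff)
  then obtain x0 where x0: "(\<lambda>k. S k x0) \<longlonglongrightarrow> g x0"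
    using eventually_happens'[OF ae_filter_bot] by blast
  define chi where "chi x = real_of_ereal (limsup (\<lambda>k. ereal (S k x)))" for x
  have "\<bar>chi x - chi y\<bar> \<le> c x y" for x y
    unfolding chi_def using S(3) convergentI[OF x0] by (rule limsup_equicontinuous_family)
  moreover have *: "AE x in M. chi x = g x"
    using lim
  proof eventually_elim
    case (elim x)
    then have "limsup (\<lambda>k. ereal (S k x)) = ereal (g x)"
      by (intro lim_imp_Limsup) auto
    then show ?case by (simp add: chi_def)
  qed
  moreover have "AE x in M. \<bar>chi x\<bar> \<le> J"
  proof -
    have "AE x in M. \<forall>k. \<bar>S k x\<bar> \<le> J" using S(2) by (simp add: AE_all_countable)
    with lim * show ?thesis
    proof eventually_elim
      case (elim x)
      then have "(\<lambda>k. \<bar>S k x\<bar>) \<longlonglongrightarrow> \<bar>chi x\<bar>" by (auto intro: tendsto_rabs)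
      then show ?case using elim by (intro LIMSEQ_le_const2) auto
    qed
  qed
  ultimately show ?thesis by blast
qed

section \<open>Strong continuity of the Koopman operators\<close>

text \<open>Continuity of almost every path is the source of joint measurability and of strong continuity. The
Lipschitz property of the paths enters later, as Hoelder continuity of \<open>\<chi>\<close> along them.\<close>

locale continuous_semiflow = prob_space M for M :: "'a::metric_space measure" +
  fixes F :: "real \<Rightarrow> 'a \<Rightarrow> 'a"
  assumes sets_M[measurable_cong]: "sets M = sets borel"
    and semiflow: "measure_preserving_semiflow M F"
    and AE_continuous: "AE x in M. continuous_on {0..} (\<lambda>t. F t x)"
begin

lemma space_M[simp]: "space M = UNIV"
  using sets_eq_imp_space_eq[OF sets_M] by simp

lemma F_0[simp]: "F 0 x = x"
  using semiflow by (simp add: measure_preserving_semiflow_def)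

lemma F_add: "0 \<le> s \<Longrightarrow> 0 \<le> t \<Longrightarrow> F (s + t) x = F s (F t x)"
  using semiflow by (simp add: measure_preserving_semiflow_def)

lemma measurable_F: "0 \<le> t \<Longrightarrow> F t \<in> measurable M M"
  using semiflow by (simp add: measure_preserving_semiflow_def)

lemma distr_F: "0 \<le> t \<Longrightarrow> distr M M (F t) = M"
  using semiflow by (simp add: measure_preserving_semiflow_def)

lemma integral_F:
  "0 \<le> t \<Longrightarrow> w \<in> borel_measurable M \<Longrightarrow> (\<integral>x. w (F t x) \<partial>M) = (\<integral>x. w x \<partial>M)" for w :: "'a \<Rightarrow> real"
  using integral_distr[OF measurable_F[of t], of w] by (simp add: distr_F)

lemma integrable_F: "0 \<le> t \<Longrightarrow> integrable M w \<Longrightarrow> integrable M (\<lambda>x. w (F t x))" for w :: "'a \<Rightarrow> real"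
  using integrable_distr_eq[OF measurable_F[of t], of w] by (simp add: distr_F)

lemma AE_F: "0 \<le> t \<Longrightarrow> AE x in M. P x \<Longrightarrow> AE x in M. P (F t x)"
  by (rule AE_distrD[OF measurable_F]) (assumption, subst distr_F)

text \<open>The set of points with a continuous path may fail to be measurable, so a measurable subset of full
measure is selected.\<close>

definition regular_points :: "'a set" where
  "regular_points = (SOME A. A \<in> sets M \<and> (AE x in M. x \<in> A) \<and> (\<forall>x\<in>A. continuous_on {0..} (\<lambda>t. F t x)))"

lemma regular_points: "regular_points \<in> sets M" "AE x in M. x \<in> regular_points" "x \<in> regular_points \<Longrightarrow> continuous_on {0..} (\<lambda>t. F t x)"
proof -
  obtain N where N: "{x \<in> space M. \<not> continuous_on {0..} (\<lambda>t. F t x)} \<subseteq> N" "N \<in> null_sets M"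
    using AE_continuous unfolding eventually_ae_filter by auto
  have "\<exists>A. A \<in> sets M \<and> (AE x in M. x \<in> A) \<and> (\<forall>x\<in>A. continuous_on {0..} (\<lambda>t. F t x))"
  proof (intro exI[of _ "space M - N"] conjI)
    show "AE x in M. x \<in> space M - N" using AE_not_in[OF N(2)] by auto
  qed (use N in auto)
  from someI_ex[OF this, folded regular_points_def]
  show "regular_points \<in> sets M" "AE x in M. x \<in> regular_points" "x \<in> regular_points \<Longrightarrow> continuous_on {0..} (\<lambda>t. F t x)" by auto
qed

text \<open>A modification of \<open>F\<close> on a null set, extended to negative times, all of whose paths are continuous. It
loses the semigroup property but is jointly measurable.\<close>

definition Fcont :: "real \<Rightarrow> 'a \<Rightarrow> 'a" where
  "Fcont t x = (if x \<in> regular_points then F (max 0 t) x else x)"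

lemma Fcont_eq: "x \<in> regular_points \<Longrightarrow> 0 \<le> t \<Longrightarrow> Fcont t x = F t x"
  by (simp add: Fcont_def max_def)

lemma continuous_Fcont: "continuous_on UNIV (\<lambda>t. Fcont t x)"
proof (cases "x \<in> regular_points")
  case True
  have "continuous_on UNIV (\<lambda>t. F (max 0 t) x)"
    by (rule continuous_on_compose2[OF regular_points(3)[OF True], where f="\<lambda>t. max 0 t"]) (auto intro!: continuous_intros)
  then show ?thesis using True by (simp add: Fcont_def)
qed (simp add: Fcont_def)

text \<open>Being measurable in \<open>x\<close> and continuous in \<open>t\<close>, the map is the pointwise limit of its values at the grid
points below \<open>t\<close>. Pointwise limits of Borel maps into a metric space are Borel even when the space is
not separable.\<close>

lemma measurable_Fcont: "(\<lambda>(t, x). Fcont t x) \<in> measurable (borel \<Otimes>\<^sub>M M) M"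
proof -
  have regular_points_meas[measurable]: "regular_points \<in> sets M" by (rule regular_points)
  have sec: "Fcont t \<in> measurable M M" for t
  proof -
    have [measurable]: "F (max 0 t) \<in> measurable M M" by (intro measurable_F) auto
    show ?thesis unfolding Fcont_def by measurable
  qed
  have "(\<lambda>p. Fcont (fst p) (snd p)) \<in> borel_measurable (borel \<Otimes>\<^sub>M M)"
  proof (rule borel_measurable_LIMSEQ_metric)
    fix n :: nat
    show "(\<lambda>p. Fcont (of_int \<lfloor>real (Suc n) * fst p\<rfloor> / real (Suc n)) (snd p)) \<in> borel_measurable (borel \<Otimes>\<^sub>M M)"
    proof (rule measurable_compose_countable[where f="\<lambda>i p. Fcont (of_int i / real (Suc n)) (snd p)"])
      show "(\<lambda>p. Fcont (of_int i / real (Suc n)) (snd p)) \<in> borel_measurable (borel \<Otimes>\<^sub>M M)" for i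
        using measurable_compose[OF measurable_snd sec[of "of_int i / real (Suc n)"]]
        by (simp add: measurable_cong_sets[OF refl sets_M])
      show "(\<lambda>p. \<lfloor>real (Suc n) * fst p\<rfloor>) \<in> borel \<Otimes>\<^sub>M M \<rightarrow>\<^sub>M count_space UNIV" by measurable
    qed
  next
    fix p :: "real \<times> 'a"
    have "(\<lambda>n. of_int \<lfloor>real (Suc n) * fst p\<rfloor> / real (Suc n)) \<longlonglongrightarrow> fst p"
    proof (rule LIMSEQ_Suc, rule real_tendsto_sandwich)
      show "eventually (\<lambda>n. fst p - 1 / real n \<le> of_int \<lfloor>real n * fst p\<rfloor> / real n) sequentially"
      proof (intro eventually_sequentiallyI[of 1])
        fix n :: nat assume "1 \<le> n"
        moreover have "real n * fst p - 1 \<le> of_int \<lfloor>real n * fst p\<rfloor>" by linarith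
        ultimately have "(real n * fst p - 1) / real n \<le> of_int \<lfloor>real n * fst p\<rfloor> / real n"
          by (intro divide_right_mono) auto
        with \<open>1 \<le> n\<close> show "fst p - 1 / real n \<le> of_int \<lfloor>real n * fst p\<rfloor> / real n"
          by (simp add: diff_divide_distrib)
      qed
      show "eventually (\<lambda>n. of_int \<lfloor>real n * fst p\<rfloor> / real n \<le> fst p) sequentially"
      proof (intro eventually_sequentiallyI[of 1])
        fix n :: nat assume "1 \<le> n"
        moreover have "of_int \<lfloor>real n * fst p\<rfloor> \<le> real n * fst p" by linarith
        ultimately show "of_int \<lfloor>real n * fst p\<rfloor> / real n \<le> fst p"
          by (simp add: field_simps)
      qed
      show "(\<lambda>n. fst p - 1 / real n) \<longlonglongrightarrow> fst p"
        using tendsto_diff[OF tendsto_const lim_1_over_n, of "fst p"] by simp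
    qed simp
    moreover have "isCont (\<lambda>t. Fcont t (snd p)) (fst p)"
      using continuous_Fcont by (simp add: continuous_on_eq_continuous_at)
    ultimately show "(\<lambda>n. Fcont (of_int \<lfloor>real (Suc n) * fst p\<rfloor> / real (Suc n)) (snd p)) \<longlonglongrightarrow> Fcont (fst p) (snd p)"
      using isCont_tendsto_compose by fastforce
  qed
  then show ?thesis by (simp add: case_prod_beta' measurable_cong_sets[OF refl sets_M])
qed

text \<open>Continuity at time \<open>0\<close> in \<open>L\<^sup>1\<close>, phrased with sequences so that dominated convergence applies.\<close>

definition L1_continuous_orbit :: "('a \<Rightarrow> real) \<Rightarrow> bool" where
  "L1_continuous_orbit w \<longleftrightarrow> integrable M w \<and>
     (\<forall>h. (\<forall>n. 0 \<le> h n) \<longrightarrow> h \<longlonglongrightarrow> 0 \<longrightarrow> (\<lambda>n::nat. \<integral>x. \<bar>w (F (h n) x) - w x\<bar> \<partial>M) \<longlonglongrightarrow> 0)"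

lemma L1_continuous_orbit_add:
  assumes "L1_continuous_orbit w" "L1_continuous_orbit w'"
  shows "L1_continuous_orbit (\<lambda>x. w x + w' x)"
  unfolding L1_continuous_orbit_def
proof (intro conjI allI impI)
  have int: "integrable M w" "integrable M w'" using assms by (auto simp: L1_continuous_orbit_def)
  then show "integrable M (\<lambda>x. w x + w' x)" by simp
  fix h :: "nat \<Rightarrow> real" assume h: "\<forall>n. 0 \<le> h n" "h \<longlonglongrightarrow> 0"
  have "(\<lambda>n. (\<integral>x. \<bar>w (F (h n) x) - w x\<bar> \<partial>M) + (\<integral>x. \<bar>w' (F (h n) x) - w' x\<bar> \<partial>M)) \<longlonglongrightarrow> 0 + 0"
    using assms h by (intro tendsto_add) (auto simp: L1_continuous_orbit_def)
  then have lim: "(\<lambda>n. (\<integral>x. \<bar>w (F (h n) x) - w x\<bar> \<partial>M) + (\<integral>x. \<bar>w' (F (h n) x) - w' x\<bar> \<partial>M)) \<longlonglongrightarrow> 0" by simp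
  show "(\<lambda>n. \<integral>x. \<bar>(w (F (h n) x) + w' (F (h n) x)) - (w x + w' x)\<bar> \<partial>M) \<longlonglongrightarrow> 0"
  proof (rule tendsto_sandwich[OF _ _ tendsto_const lim]; intro always_eventually allI)
    fix n
    have i: "integrable M (\<lambda>x. w (F (h n) x))" "integrable M (\<lambda>x. w' (F (h n) x))"
      using int h by (auto intro: integrable_F)
    have "(\<integral>x. \<bar>(w (F (h n) x) + w' (F (h n) x)) - (w x + w' x)\<bar> \<partial>M) \<le>
        (\<integral>x. \<bar>w (F (h n) x) - w x\<bar> + \<bar>w' (F (h n) x) - w' x\<bar> \<partial>M)"
      using int i by (intro integral_mono) auto
    also have "\<dots> = (\<integral>x. \<bar>w (F (h n) x) - w x\<bar> \<partial>M) + (\<integral>x. \<bar>w' (F (h n) x) - w' x\<bar> \<partial>M)"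
      using int i by (intro Bochner_Integration.integral_add) auto
    finally show "(\<integral>x. \<bar>(w (F (h n) x) + w' (F (h n) x)) - (w x + w' x)\<bar> \<partial>M) \<le> \<dots>" .
  qed auto
qed

lemma L1_continuous_orbit_scale:
  assumes "L1_continuous_orbit w"
  shows "L1_continuous_orbit (\<lambda>x. w x * c)"
proof -
  have eq: "\<bar>w y * c - w x * c\<bar> = \<bar>w y - w x\<bar> * \<bar>c\<bar>" for x y
    by (simp add: left_diff_distrib[symmetric] abs_mult)
  show ?thesis
    using assms unfolding L1_continuous_orbit_def eq by (auto intro!: tendsto_mult_left_zero)
qed

text \<open>An \<open>e/3\<close> argument: replacing \<open>w\<close> by \<open>s i\<close> costs the same in \<open>L\<^sup>1\<close> before and after composition with \<open>F\<close>,
since \<open>F\<close> preserves the measure.\<close>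

lemma L1_continuous_orbit_L1_limit:
  assumes s: "\<And>i. L1_continuous_orbit (s i)" and w: "integrable M w"
    and lim: "(\<lambda>i::nat. \<integral>x. \<bar>s i x - w x\<bar> \<partial>M) \<longlonglongrightarrow> 0"
  shows "L1_continuous_orbit w"
  unfolding L1_continuous_orbit_def
proof (intro conjI allI impI w LIMSEQ_I)
  fix h :: "nat \<Rightarrow> real" and e :: real assume h: "\<forall>n. 0 \<le> h n" "h \<longlonglongrightarrow> 0" and "0 < e"
  then have e3: "0 < e / 3" by simp
  obtain i where i: "(\<integral>x. \<bar>s i x - w x\<bar> \<partial>M) < e / 3"
    using order_tendstoD(2)[OF lim e3] by (auto simp: eventually_sequentially)
  have int: "integrable M (s i)" using s by (auto simp: L1_continuous_orbit_def)
  have "(\<lambda>n. \<integral>x. \<bar>s i (F (h n) x) - s i x\<bar> \<partial>M) \<longlonglongrightarrow> 0"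
    using s h by (auto simp: L1_continuous_orbit_def)
  from order_tendstoD(2)[OF this e3] obtain N where
    N: "\<And>n. n \<ge> N \<Longrightarrow> (\<integral>x. \<bar>s i (F (h n) x) - s i x\<bar> \<partial>M) < e / 3"
    by (auto simp: eventually_sequentially)
  have "norm ((\<integral>x. \<bar>w (F (h n) x) - w x\<bar> \<partial>M) - 0) < e" if "n \<ge> N" for n
  proof -
    have ints: "integrable M (\<lambda>x. w (F (h n) x))" "integrable M (\<lambda>x. s i (F (h n) x))"
      using w int h by (auto intro: integrable_F)
    have "(\<integral>x. \<bar>w (F (h n) x) - w x\<bar> \<partial>M) \<le>
        (\<integral>x. (\<bar>s i (F (h n) x) - w (F (h n) x)\<bar> + \<bar>s i (F (h n) x) - s i x\<bar>) + \<bar>s i x - w x\<bar> \<partial>M)"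
      using w int ints by (intro integral_mono) auto
    also have "\<dots> = (\<integral>x. \<bar>s i (F (h n) x) - w (F (h n) x)\<bar> \<partial>M) + (\<integral>x. \<bar>s i (F (h n) x) - s i x\<bar> \<partial>M)
        + (\<integral>x. \<bar>s i x - w x\<bar> \<partial>M)"
      using w int ints by simp
    also have "(\<integral>x. \<bar>s i (F (h n) x) - w (F (h n) x)\<bar> \<partial>M) = (\<integral>x. \<bar>s i x - w x\<bar> \<partial>M)"
      using w int h by (intro integral_F[where w="\<lambda>x. \<bar>s i x - w x\<bar>"]) auto
    finally show ?thesis using i N[OF that] by simp
  qed
  then show "\<exists>N. \<forall>n\<ge>N. norm ((\<integral>x. \<bar>w (F (h n) x) - w x\<bar> \<partial>M) - 0) < e" by blast
qed

lemma L1_continuous_orbit_dominated_limit: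
  assumes s: "\<And>i. L1_continuous_orbit (s i)" and w: "integrable M w" "integrable M d"
    and lim: "\<And>x. (\<lambda>i::nat. s i x) \<longlonglongrightarrow> w x" and dom: "\<And>i x. \<bar>s i x\<bar> \<le> d x"
  shows "L1_continuous_orbit w"
proof (rule L1_continuous_orbit_L1_limit[OF s w(1)])
  have int: "integrable M (s i)" for i using s by (auto simp: L1_continuous_orbit_def)
  have "(\<lambda>i. \<integral>x. \<bar>s i x - w x\<bar> \<partial>M) \<longlonglongrightarrow> (\<integral>x. 0 \<partial>M)"
  proof (rule integral_dominated_convergence[where w="\<lambda>x. d x + \<bar>w x\<bar>"])
    show "AE x in M. (\<lambda>i. \<bar>s i x - w x\<bar>) \<longlonglongrightarrow> 0"
      using tendsto_rabs_zero[OF LIM_zero[OF lim]] by simp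
    show "AE x in M. norm \<bar>s i x - w x\<bar> \<le> d x + \<bar>w x\<bar>" for i
    proof (intro AE_I2)
      show "norm \<bar>s i x - w x\<bar> \<le> d x + \<bar>w x\<bar>" for x using dom[of i x] by simp
    qed
  qed (use w int in auto)
  then show "(\<lambda>i. \<integral>x. \<bar>s i x - w x\<bar> \<partial>M) \<longlonglongrightarrow> 0" by simp
qed

text \<open>A continuous path that starts in an open set \<open>U\<close> stays in \<open>U\<close> for a short time, so the measure of the
points that have left \<open>U\<close> at time \<open>h\<close> tends to zero. The measure of the points that have entered \<open>U\<close> is
the same, because \<open>F\<close> preserves the measure.\<close>

lemma L1_continuous_orbit_indicator_open:
  assumes U: "open U"
  shows "L1_continuous_orbit (indicator U)"
  unfolding L1_continuous_orbit_def
proof (intro conjI allI impI)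
  have [measurable]: "U \<in> sets M" using U sets_M by auto
  show intU: "integrable M (indicator U :: 'a \<Rightarrow> real)" by (intro integrable_real_indicator) (auto simp: emeasure_eq_measure)
  fix h :: "nat \<Rightarrow> real" assume h: "\<forall>n. 0 \<le> h n" "h \<longlonglongrightarrow> 0"
  have [measurable]: "F (h n) \<in> measurable M M" for n using h by (auto intro: measurable_F)
  have intF: "integrable M (\<lambda>x. indicator U (F (h n) x) :: real)" for n
    using intU h by (auto intro: integrable_F)
  have "(\<lambda>n. \<integral>x. indicator U x * (1 - indicator U (F (h n) x)) \<partial>M :: real) \<longlonglongrightarrow> (\<integral>x. 0 \<partial>M)"
  proof (rule integral_dominated_convergence[where w="\<lambda>_. 1"])
    show "AE x in M. (\<lambda>n. indicator U x * (1 - indicator U (F (h n) x)) :: real) \<longlonglongrightarrow> 0"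
      using regular_points(2)
    proof eventually_elim
      case (elim x)
      have "(\<lambda>n. F (h n) x) \<longlonglongrightarrow> x"
        using continuous_on_tendsto_compose[OF regular_points(3)[OF elim] h(2)] h(1) by auto
      then have "x \<in> U \<Longrightarrow> eventually (\<lambda>n. F (h n) x \<in> U) sequentially"
        using U by (auto dest: topological_tendstoD)
      then show ?case
        by (cases "x \<in> U") (auto intro!: tendsto_eventually elim: eventually_mono)
    qed
  qed (auto simp: indicator_def)
  then have lim: "(\<lambda>n. 2 * (\<integral>x. indicator U x * (1 - indicator U (F (h n) x)) \<partial>M :: real)) \<longlonglongrightarrow> 0"
    by (intro tendsto_mult_right_zero) simp
  \<comment> \<open>Pointwise \<open>\<bar>b - a\<bar> = (b - a) + 2 * a * (1 - b)\<close> for indicators, and \<open>b - a\<close> has integral zero.\<close>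
  have "2 * (\<integral>x. indicator U x * (1 - indicator U (F (h n) x)) \<partial>M :: real) =
      (\<integral>x. \<bar>indicator U (F (h n) x) - indicator U x\<bar> \<partial>M)" for n
  proof -
    have i1: "integrable M (\<lambda>x. indicator U x * (1 - indicator U (F (h n) x)) :: real)"
      by (rule integrable_const_bound[where B=1]) (auto simp: indicator_def)
    have "(\<integral>x. \<bar>indicator U (F (h n) x) - indicator U x\<bar> \<partial>M) =
        (\<integral>x. (indicator U (F (h n) x) - indicator U x) + 2 * (indicator U x * (1 - indicator U (F (h n) x))) \<partial>M :: real)"
      by (intro Bochner_Integration.integral_cong) (auto simp: indicator_def)
    also have "\<dots> = (\<integral>x. indicator U (F (h n) x) \<partial>M) - (\<integral>x. indicator U x \<partial>M)
        + 2 * (\<integral>x. indicator U x * (1 - indicator U (F (h n) x)) \<partial>M :: real)"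
      using intU intF[of n] i1 by simp
    also have "(\<integral>x. indicator U (F (h n) x) \<partial>M) = (\<integral>x. indicator U x \<partial>M :: real)"
      using h(1) by (intro integral_F) auto
    finally show ?thesis by simp
  qed
  with lim show "(\<lambda>n. \<integral>x. \<bar>indicator U (F (h n) x) - indicator U x\<bar> \<partial>M :: real) \<longlonglongrightarrow> 0"
    by (simp only:)
qed

text \<open>The sets whose indicators have a continuous orbit form a Dynkin system that contains the open sets.\<close>

lemma L1_continuous_orbit_indicator:
  assumes "A \<in> sets M"
  shows "L1_continuous_orbit (indicator A)"
proof -
  have sig: "sets M = sigma_sets UNIV {S. open S}"
    using sets_M by (simp add: borel_def)
  have "Int_stable {S::'a set. open S}" "{S::'a set. open S} \<subseteq> Pow UNIV"
    by (auto simp: Int_stable_def)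
  moreover have "A \<in> sigma_sets UNIV {S. open S}" using assms sig by simp
  ultimately show ?thesis
  proof (induction rule: sigma_sets_induct_disjoint)
    case (basic A) then show ?case using L1_continuous_orbit_indicator_open by simp
  next
    case empty then show ?case using L1_continuous_orbit_indicator_open[OF open_empty] by (simp only:)
  next
    case (compl A)
    have "(indicator (UNIV - A) :: 'a \<Rightarrow> real) = (\<lambda>x. indicator UNIV x + indicator A x * (-1))"
      by (auto simp: indicator_def)
    then show ?case
      using L1_continuous_orbit_add[OF L1_continuous_orbit_indicator_open[of UNIV] L1_continuous_orbit_scale[OF compl(2), of "-1"]]
      by simp
  next
    case (union A)
    have fin: "L1_continuous_orbit (indicator (\<Union>i<n. A i))" for n
    proof (induction n)
      case 0 then show ?case using L1_continuous_orbit_indicator_open[OF open_empty] by (simp only: lessThan_0 UN_empty)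
    next
      case (Suc n)
      have "A i \<inter> A n = {}" if "i < n" for i
        using disjoint_family_onD[OF union(1), of i n] that by simp
      then have disj: "(\<Union>i<n. A i) \<inter> A n = {}" by blast
      have Suc_eq: "(\<Union>i<Suc n. A i) = (\<Union>i<n. A i) \<union> A n" by (auto simp: less_Suc_eq)
      have "(indicator (\<Union>i<Suc n. A i) :: 'a \<Rightarrow> real) = (\<lambda>x. indicator (\<Union>i<n. A i) x + indicator (A n) x)"
        unfolding Suc_eq by (intro ext indicator_disj_union disj)
      then show ?case using L1_continuous_orbit_add[OF Suc union(3)[of n]] by (simp only:)
    qed
    have meas: "(\<Union>i. A i) \<in> sets M"
      using union(2) by (intro sets.countable_UN) (simp add: sig)
    show ?case
    proof (rule L1_continuous_orbit_dominated_limit[OF fin, where d="\<lambda>_. 1"])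
      show "integrable M (indicator (\<Union>i. A i) :: 'a \<Rightarrow> real)"
        using meas by (intro integrable_real_indicator) (auto simp: emeasure_eq_measure)
      show "(\<lambda>n. indicator (\<Union>i<n. A i) x :: real) \<longlonglongrightarrow> indicator (\<Union>i. A i) x" for x
        by (rule LIMSEQ_indicator_UN)
    qed (auto simp: indicator_def)
  qed
qed

lemma L1_continuous_orbit: "integrable M w \<Longrightarrow> L1_continuous_orbit w"
proof (induction rule: integrable_induct)
  case (base A c)
  then show ?case using L1_continuous_orbit_scale[OF L1_continuous_orbit_indicator] by simp
next
  case (add f g)
  then show ?case using L1_continuous_orbit_add by simp
next
  case (lim f s)
  then show ?case by (intro L1_continuous_orbit_dominated_limit[of s f "\<lambda>x. 2 * \<bar>f x\<bar>"]) auto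
qed

lemma Koopman_L1_modulus:
  fixes w :: "'a \<Rightarrow> real"
  assumes "integrable M w" and "0 < e"
  shows "\<exists>d>0. \<forall>h. 0 \<le> h \<longrightarrow> h \<le> d \<longrightarrow> (\<integral>x. \<bar>w (F h x) - w x\<bar> \<partial>M) \<le> e"
proof (rule ccontr)
  assume contra: "\<not> ?thesis"
  have "\<exists>h. 0 \<le> h \<and> h \<le> d \<and> e < (\<integral>x. \<bar>w (F h x) - w x\<bar> \<partial>M)" if "0 < d" for d
    using contra that by (auto simp: not_le)
  then have "\<exists>h. 0 \<le> h \<and> h \<le> 1 / real (Suc n) \<and> e < (\<integral>x. \<bar>w (F h x) - w x\<bar> \<partial>M)" for n :: nat
    by simp
  then obtain h where h: "\<And>n::nat. 0 \<le> h n" "\<And>n. h n \<le> 1 / real (Suc n)"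
    "\<And>n. e < (\<integral>x. \<bar>w (F (h n) x) - w x\<bar> \<partial>M)"
    by metis
  have "h \<longlonglongrightarrow> 0"
    by (rule tendsto_sandwich[OF _ _ tendsto_const LIMSEQ_Suc[OF lim_1_over_n]]) (use h in auto)
  then have "(\<lambda>n. \<integral>x. \<bar>w (F (h n) x) - w x\<bar> \<partial>M) \<longlonglongrightarrow> 0"
    using L1_continuous_orbit[OF assms(1)] h(1) by (auto simp: L1_continuous_orbit_def)
  then have "e \<le> 0" by (rule LIMSEQ_le_const) (use h(3) in \<open>auto intro: less_imp_le\<close>)
  then show False using \<open>0 < e\<close> by simp
qed

end

section \<open>Continuity of the dual orbit and integrals along paths\<close>

text \<open>The family \<open>f t\<close> is the orbit \<open>L\<^sub>t v\<close> of an everywhere bounded observable, characterised by duality with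
bounded Borel functions.\<close>

locale dual_orbit = continuous_semiflow M F for M :: "'a::metric_space measure" and F +
  fixes v :: "'a \<Rightarrow> real" and C :: real and f :: "real \<Rightarrow> 'a \<Rightarrow> real"
  assumes measurable_v[measurable]: "v \<in> borel_measurable M"
    and v_bound: "\<And>x. \<bar>v x\<bar> \<le> C"
    and integrable_f: "\<And>t. 0 < t \<Longrightarrow> integrable M (f t)"
    and duality: "\<And>t w B. 0 < t \<Longrightarrow> w \<in> borel_measurable M \<Longrightarrow> (\<And>x. \<bar>w x\<bar> \<le> B) \<Longrightarrow>
        (\<integral>x. f t x * w x \<partial>M) = (\<integral>x. v x * w (F t x) \<partial>M)"
begin

lemma C_nonneg: "0 \<le> C"
  using v_bound[of undefined] by simp

lemma integrable_bounded:
  "g \<in> borel_measurable M \<Longrightarrow> (\<And>x. \<bar>g x\<bar> \<le> B) \<Longrightarrow> integrable M g" for g :: "'a \<Rightarrow> real"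
  by (rule integrable_const_bound[of _ B]) auto

text \<open>Test the difference against its own sign \<open>w\<close>. With \<open>g = w \<circ> F\<^sub>s\<close> duality turns the distance into
\<open>\<integral> v (g \<circ> F\<^sub>h) - \<integral> v g\<close>, and by invariance \<open>\<integral> v g = \<integral> (v \<circ> F\<^sub>h) (g \<circ> F\<^sub>h)\<close>.\<close>

lemma L1_dist_le:
  assumes "0 < s" "0 \<le> h"
  shows "(\<integral>x. \<bar>f (s + h) x - f s x\<bar> \<partial>M) \<le> (\<integral>x. \<bar>v (F h x) - v x\<bar> \<partial>M)"
proof -
  have st: "0 < s + h" "0 \<le> s" using assms by auto
  note int[simp] = integrable_f[OF st(1)] integrable_f[OF assms(1)]
  note [measurable] = borel_measurable_integrable[OF int(1)] borel_measurable_integrable[OF int(2)]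
    measurable_F[OF st(2)] measurable_F[OF assms(2)]
  define w where "w x = sgn (f (s + h) x - f s x)" for x
  define g where "g x = w (F s x)" for x
  have [measurable]: "w \<in> borel_measurable M" unfolding w_def by measurable
  have [measurable]: "g \<in> borel_measurable M" unfolding g_def by measurable
  have wb: "\<bar>w x\<bar> \<le> 1" for x by (auto simp: w_def sgn_if)
  have gb: "\<bar>g x\<bar> \<le> 1" for x by (simp add: g_def wb)
  have C1: "\<bar>a * b\<bar> \<le> C" if "\<bar>a\<bar> \<le> C" "\<bar>b\<bar> \<le> 1" for a b :: real
    using mult_mono[OF that C_nonneg] by (simp add: abs_mult)
  have fw: "integrable M (\<lambda>x. f t x * w x)" if "0 < t" for t
    by (rule Bochner_Integration.integrable_bound[OF integrable_f[OF that]])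
      (use borel_measurable_integrable[OF integrable_f[OF that]] wb in \<open>auto simp: abs_mult intro!: mult_left_le\<close>)
  have i1: "integrable M (\<lambda>x. v x * g (F h x))" "integrable M (\<lambda>x. v (F h x) * g (F h x))"
    by (rule integrable_bounded[where B=C]; use v_bound gb in \<open>auto intro!: C1\<close>)+
  have i2: "integrable M (\<lambda>x. v (F h x) - v x)"
    by (intro Bochner_Integration.integrable_diff; rule integrable_bounded[where B=C]) (use v_bound in auto)
  have "(\<integral>x. \<bar>f (s + h) x - f s x\<bar> \<partial>M) = (\<integral>x. f (s + h) x * w x - f s x * w x \<partial>M)"
    by (intro Bochner_Integration.integral_cong) (auto simp: w_def abs_sgn algebra_simps)
  also have "\<dots> = (\<integral>x. f (s + h) x * w x \<partial>M) - (\<integral>x. f s x * w x \<partial>M)"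
    using fw st assms by (intro Bochner_Integration.integral_diff) auto
  also have "(\<integral>x. f (s + h) x * w x \<partial>M) = (\<integral>x. v x * g (F h x) \<partial>M)"
    using duality[OF st(1) _ wb] st assms by (simp add: g_def F_add)
  also have "(\<integral>x. f s x * w x \<partial>M) = (\<integral>x. v x * g x \<partial>M)"
    using duality[OF assms(1) _ wb] by (simp add: g_def)
  also have "(\<integral>x. v x * g x \<partial>M) = (\<integral>x. v (F h x) * g (F h x) \<partial>M)"
    using integral_F[OF assms(2), of "\<lambda>x. v x * g x"] by simp
  also have "(\<integral>x. v x * g (F h x) \<partial>M) - (\<integral>x. v (F h x) * g (F h x) \<partial>M) =
      (\<integral>x. v x * g (F h x) - v (F h x) * g (F h x) \<partial>M)"
    using i1 by simp
  also have "\<dots> \<le> (\<integral>x. \<bar>v (F h x) - v x\<bar> \<partial>M)"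
  proof (rule integral_mono)
    fix x
    have "v x * g (F h x) - v (F h x) * g (F h x) = (v x - v (F h x)) * g (F h x)"
      by (simp add: algebra_simps)
    also have "\<dots> \<le> \<bar>(v x - v (F h x)) * g (F h x)\<bar>" by simp
    also have "\<dots> \<le> \<bar>v x - v (F h x)\<bar>"
      using gb by (simp add: abs_mult mult_left_le)
    finally show "v x * g (F h x) - v (F h x) * g (F h x) \<le> \<bar>v (F h x) - v x\<bar>" by simp
  qed (use i1 i2 in auto)
  finally show ?thesis .
qed

lemma L1_uniformly_continuous_dual_orbit: "L1_uniformly_continuous M f"
  unfolding L1_uniformly_continuous_def
proof (intro conjI allI impI)
  show "integrable M (f t)" if "0 < t" for t using that by (rule integrable_f)
  fix e :: real assume "0 < e"
  have "integrable M v" using v_bound by (intro integrable_bounded) auto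
  from Koopman_L1_modulus[OF this \<open>0 < e\<close>] obtain d where d: "0 < d"
    "\<And>h. 0 \<le> h \<Longrightarrow> h \<le> d \<Longrightarrow> (\<integral>x. \<bar>v (F h x) - v x\<bar> \<partial>M) \<le> e" by blast
  have le: "(\<integral>x. \<bar>f t x - f s x\<bar> \<partial>M) \<le> e" if "0 < s" "s \<le> t" "t - s \<le> d" for s t
    using L1_dist_le[of s "t - s"] d(2)[of "t - s"] that by simp
  show "\<exists>d>0. \<forall>s>0. \<forall>t>0. \<bar>s - t\<bar> \<le> d \<longrightarrow> (\<integral>x. \<bar>f s x - f t x\<bar> \<partial>M) \<le> e"
  proof (intro exI[of _ d] conjI allI impI d(1))
    fix s t :: real assume st: "0 < s" "0 < t" "\<bar>s - t\<bar> \<le> d"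
    show "(\<integral>x. \<bar>f s x - f t x\<bar> \<partial>M) \<le> e"
    proof (cases "s \<le> t")
      case True
      then show ?thesis using le[of s t] st by (simp add: abs_minus_commute)
    next
      case False
      then show ?thesis using le[of t s] st by simp
    qed
  qed
qed

text \<open>The flow integral along the paths of \<open>Fcont\<close>. It is measurable in \<open>x\<close>, whereas \<open>flow_integral\<close> agrees with a
measurable function only almost everywhere.\<close>

definition time_integral :: "real \<Rightarrow> 'a \<Rightarrow> real" where
  "time_integral t x = (LBINT r:{0..t}. v (Fcont r x))"

lemma measurable_v_Fcont: "(\<lambda>(t, x). v (Fcont t x)) \<in> borel_measurable (borel \<Otimes>\<^sub>M M)"
  using measurable_compose[OF measurable_Fcont measurable_v] by (simp add: case_prod_beta')

lemma measurable_orbit: "(\<lambda>r. v (Fcont r x)) \<in> borel_measurable borel"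
proof -
  have "(\<lambda>r. (r, x)) \<in> borel \<rightarrow>\<^sub>M borel \<Otimes>\<^sub>M M" by simp
  from measurable_compose[OF this measurable_v_Fcont] show ?thesis by simp
qed

lemma set_integrable_orbit: "set_integrable lborel {a..b} (\<lambda>r. v (Fcont r x))"
  unfolding set_integrable_def
proof (rule integrableI_bounded_set_indicator[where B=C])
  show "(\<lambda>r. v (Fcont r x)) \<in> borel_measurable lborel" using measurable_orbit by simp
qed (use v_bound in \<open>auto simp: emeasure_lborel_Icc_eq\<close>)

lemma measurable_time_integral[measurable]: "time_integral t \<in> borel_measurable M"
proof -
  have "(\<lambda>(x, r). v (Fcont r x)) \<in> borel_measurable (M \<Otimes>\<^sub>M lborel)"
    using measurable_compose[OF measurable_pair_swap' measurable_v_Fcont]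
    by (simp add: case_prod_beta' measurable_cong_sets[OF sets_pair_measure_cong[OF refl sets_lborel] refl])
  then show ?thesis
    unfolding time_integral_def set_lebesgue_integral_def
    by (intro lborel.borel_measurable_lebesgue_integral) (simp add: case_prod_beta')
qed

lemma orbit_integral_bound:
  assumes "a \<le> b"
  shows "\<bar>LBINT r:{a..b}. v (Fcont r x)\<bar> \<le> C * (b - a)"
proof -
  have "norm (LBINT r:{a..b}. v (Fcont r x)) \<le> (\<integral>r. norm (indicator {a..b} r *\<^sub>R v (Fcont r x)) \<partial>lborel)"
    unfolding set_lebesgue_integral_def by (rule integral_norm_bound)
  also have "\<dots> \<le> (\<integral>r. indicator {a..b} r * C \<partial>lborel)"
  proof (rule integral_mono)
    show "integrable lborel (\<lambda>r. norm (indicator {a..b} r *\<^sub>R v (Fcont r x)))"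
      using set_integrable_orbit[of a b x] by (intro integrable_norm) (simp add: set_integrable_def)
    show "integrable lborel (\<lambda>r. indicator {a..b} r * C)"
      by (intro integrable_mult_left integrable_real_indicator) (auto simp: emeasure_lborel_Icc_eq)
  qed (use v_bound in \<open>auto simp: indicator_def\<close>)
  also have "\<dots> = C * (b - a)" using assms by simp
  finally show ?thesis by simp
qed

lemma time_integral_bound: "0 \<le> t \<Longrightarrow> \<bar>time_integral t x\<bar> \<le> C * t"
  using orbit_integral_bound[of 0 t x] by (simp add: time_integral_def)

lemma time_integral_split:
  assumes "0 \<le> s" "0 \<le> t"
  shows "time_integral (s + t) x = time_integral s x + (LBINT r:{s..s + t}. v (Fcont r x))"
proof -
  have "time_integral (s + t) x = (LBINT r:{0..s} \<union> {s..s + t}. v (Fcont r x))"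
    unfolding time_integral_def using assms by (simp add: ivl_disj_un_two_touch)
  also have "\<dots> = time_integral s x + (LBINT r:{s..s + t}. v (Fcont r x))"
    unfolding time_integral_def
  proof (rule set_integral_Un_AE)
    show "AE r in lborel. \<not> (r \<in> {0..s} \<and> r \<in> {s..s + t})"
      using AE_lborel_singleton[of s] by eventually_elim auto
  qed (auto intro: set_integrable_orbit)
  finally show ?thesis .
qed

lemma flow_integral_eq_time_integral: "x \<in> regular_points \<Longrightarrow> flow_integral F v t x = time_integral t x"
  unfolding flow_integral_def time_integral_def
  by (intro set_lebesgue_integral_cong) (auto simp: Fcont_eq)

lemma time_integral_cocycle:
  assumes "0 \<le> s" "0 \<le> t" "x \<in> regular_points" "F s x \<in> regular_points"
  shows "time_integral (s + t) x = time_integral s x + time_integral t (F s x)"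
proof -
  have "time_integral (s + t) x = time_integral s x + (LBINT r:{s..s + t}. v (Fcont r x))"
    using assms by (intro time_integral_split)
  also have "(LBINT r:{s..s + t}. v (Fcont r x)) = (\<integral>r. indicator {s..s + t} (s + 1 * r) *\<^sub>R v (Fcont (s + 1 * r) x) \<partial>lborel)"
    unfolding set_lebesgue_integral_def by (subst lborel_integral_real_affine[where c=1 and t=s]) auto
  also have "\<dots> = time_integral t (F s x)"
    unfolding time_integral_def set_lebesgue_integral_def
  proof (rule Bochner_Integration.integral_cong[OF refl])
    fix r
    show "indicator {s..s + t} (s + 1 * r) *\<^sub>R v (Fcont (s + 1 * r) x) = indicator {0..t} r *\<^sub>R v (Fcont r (F s x))"
      using assms F_add[of r s x] by (auto simp: indicator_def Fcont_eq add.commute)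
  qed
  finally show ?thesis .
qed

end

section \<open>Orthogonality of the defect in the coboundary equation\<close>

text \<open>Here \<open>u\<close> is a jointly measurable version of the family \<open>f\<close>, and \<open>chi\<close> a bounded version of its integral
over time.\<close>

locale coboundary_candidate = dual_orbit M F v C f
  for M :: "'a::metric_space measure" and F v C f +
  fixes u :: "real \<Rightarrow> 'a \<Rightarrow> real" and chi :: "'a \<Rightarrow> real" and D :: real
  assumes integrable_u: "integrable (lborel_pos \<Otimes>\<^sub>M M) (case_prod u)"
    and u_eq_f: "\<And>t. 0 < t \<Longrightarrow> AE x in M. u t x = f t x"
    and measurable_chi[measurable]: "chi \<in> borel_measurable M"
    and chi_bound: "\<And>x. \<bar>chi x\<bar> \<le> D"
    and chi_eq: "AE x in M. chi x = (\<integral>t. u t x \<partial>lborel_pos)"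
begin

definition correlation :: "('a \<Rightarrow> real) \<Rightarrow> real \<Rightarrow> real" where
  "correlation w t = (\<integral>x. v x * w (F t x) \<partial>M)"

lemma correlation_F: "0 \<le> s \<Longrightarrow> 0 \<le> t \<Longrightarrow> correlation (\<lambda>x. w (F t x)) s = correlation w (t + s)"
  by (simp add: correlation_def F_add)

text \<open>Fubini's theorem for \<open>u\<close>, followed by duality at each time.\<close>

lemma chi_test:
  assumes [measurable]: "w \<in> borel_measurable M" and wB: "\<And>x. \<bar>w x\<bar> \<le> B"
  shows "set_integrable lborel {0<..} (correlation w)"
    and "(\<integral>x. chi x * w x \<partial>M) = (LBINT t:{0<..}. correlation w t)"
proof -
  interpret N: sigma_finite_measure lborel_pos by (rule sigma_finite_lborel_pos)
  interpret pair_sigma_finite lborel_pos M ..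
  have B: "0 \<le> B" using wB[of undefined] by simp
  have int: "integrable (lborel_pos \<Otimes>\<^sub>M M) (\<lambda>(t, x). u t x * w x)"
  proof (rule Bochner_Integration.integrable_bound)
    show "integrable (lborel_pos \<Otimes>\<^sub>M M) (\<lambda>p. B * case_prod u p)"
      using integrable_u by simp
    have "(\<lambda>p. case_prod u p * w (snd p)) \<in> borel_measurable (lborel_pos \<Otimes>\<^sub>M M)"
      using borel_measurable_integrable[OF integrable_u] by measurable
    then show "(\<lambda>(t, x). u t x * w x) \<in> borel_measurable (lborel_pos \<Otimes>\<^sub>M M)"
      by (simp add: case_prod_beta')
    show "AE p in lborel_pos \<Otimes>\<^sub>M M. norm (case p of (t, x) \<Rightarrow> u t x * w x) \<le> norm (B * case_prod u p)"
    proof (intro AE_I2)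
      show "norm (case p of (t, x) \<Rightarrow> u t x * w x) \<le> norm (B * case_prod u p)" for p
        using mult_right_mono[OF wB[of "snd p"], of "\<bar>u (fst p) (snd p)\<bar>"] B
        by (simp add: case_prod_beta' abs_mult mult.commute)
    qed
  qed
  have eq: "(\<integral>x. u t x * w x \<partial>M) = correlation w t" if "0 < t" for t
  proof -
    have [measurable]: "u t \<in> borel_measurable M"
      using measurable_Pair2[OF borel_measurable_integrable[OF integrable_u], of t] that by (simp add: space_restrict_space)
    have [measurable]: "f t \<in> borel_measurable M" using integrable_f[OF that] by auto
    have "(\<integral>x. u t x * w x \<partial>M) = (\<integral>x. f t x * w x \<partial>M)"
      by (rule integral_cong_AE) (use u_eq_f[OF that] in auto)
    also have "\<dots> = correlation w t"
      unfolding correlation_def using duality[OF that assms(1) wB] .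
    finally show ?thesis .
  qed
  have "integrable lborel_pos (\<lambda>t. \<integral>x. u t x * w x \<partial>M)"
    using integrable_fst[OF int] .
  also have "?this \<longleftrightarrow> integrable lborel_pos (correlation w)"
    by (intro Bochner_Integration.integrable_cong) (auto simp: eq space_restrict_space)
  finally show "set_integrable lborel {0<..} (correlation w)"
    by (subst (asm) integrable_restrict_space) (auto simp: set_integrable_def)
  have "(\<integral>x. chi x * w x \<partial>M) = (\<integral>x. (\<integral>t. u t x * w x \<partial>lborel_pos) \<partial>M)"
  proof (rule integral_cong_AE)
    show "AE x in M. chi x * w x = (\<integral>t. u t x * w x \<partial>lborel_pos)"
      using chi_eq by eventually_elim simp
    show "(\<lambda>x. \<integral>t. u t x * w x \<partial>lborel_pos) \<in> borel_measurable M"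
      using borel_measurable_integrable[OF integrable_snd[OF int]] .
  qed measurable
  also have "\<dots> = (\<integral>t. (\<integral>x. u t x * w x \<partial>M) \<partial>lborel_pos)"
    by (rule Fubini_integral[OF int])
  also have "\<dots> = (\<integral>t. correlation w t \<partial>lborel_pos)"
    by (intro Bochner_Integration.integral_cong) (auto simp: eq space_restrict_space)
  also have "\<dots> = (LBINT t:{0<..}. correlation w t)"
    by (subst integral_restrict_space) (auto simp: set_lebesgue_integral_def)
  finally show "(\<integral>x. chi x * w x \<partial>M) = (LBINT t:{0<..}. correlation w t)" .
qed

text \<open>By invariance \<open>\<integral> (v \<circ> F\<^sub>r) (w \<circ> F\<^sub>t)\<close> depends only on \<open>t - r\<close>; it equals \<open>correlation w (t - r)\<close>. Now integrate over \<open>r\<close>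
and reflect the interval.\<close>

lemma time_integral_test:
  assumes t: "0 \<le> t" and [measurable]: "w \<in> borel_measurable M" and wB: "\<And>x. \<bar>w x\<bar> \<le> B"
  shows "(\<integral>x. time_integral t x * w (F t x) \<partial>M) = (LBINT s:{0<..t}. correlation w s)"
proof -
  have em: "emeasure (lborel \<Otimes>\<^sub>M M) ({0..<t} \<times> space M) = emeasure lborel {0..<t} * emeasure M (space M)"
    by (rule emeasure_pair_measure_Times) auto
  interpret pair_sigma_finite lborel M ..
  have [measurable]: "F t \<in> measurable M M" using t by (rule measurable_F)
  \<comment> \<open>The interval is half-open because its reflection is then \<open>(0,t]\<close>, which avoids the time \<open>0\<close>.\<close>
  define k where "k r x = indicator {0..<t} r * v (Fcont r x) * w (F t x)" for r x
  have "(\<lambda>p. v (Fcont (fst p) (snd p))) \<in> borel_measurable (borel \<Otimes>\<^sub>M M)"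
    using measurable_v_Fcont by (simp add: case_prod_beta')
  also have "borel_measurable (borel \<Otimes>\<^sub>M M) = borel_measurable (lborel \<Otimes>\<^sub>M M)"
    by (intro measurable_cong_sets sets_pair_measure_cong) auto
  finally have [measurable]: "(\<lambda>p. v (Fcont (fst p) (snd p))) \<in> borel_measurable (lborel \<Otimes>\<^sub>M M)" .
  have kint: "integrable (lborel \<Otimes>\<^sub>M M) (case_prod k)"
  proof (rule integrableI_bounded_set[where A="{0..<t} \<times> space M" and B="C * B"])
    show "{0..<t} \<times> space M \<in> sets (lborel \<Otimes>\<^sub>M M)" by simp
    have "(\<lambda>p. k (fst p) (snd p)) \<in> borel_measurable (lborel \<Otimes>\<^sub>M M)"
      unfolding k_def by measurable
    then show "case_prod k \<in> borel_measurable (lborel \<Otimes>\<^sub>M M)" by (simp add: case_prod_beta')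
    show "emeasure (lborel \<Otimes>\<^sub>M M) ({0..<t} \<times> space M) < \<infinity>"
      unfolding em using t by (simp add: emeasure_space_1 del: space_M)
    show "AE p in lborel \<Otimes>\<^sub>M M. p \<in> {0..<t} \<times> space M \<longrightarrow> norm (case_prod k p) \<le> C * B"
    proof (intro AE_I2 impI)
      show "norm (case_prod k p) \<le> C * B" if "p \<in> {0..<t} \<times> space M" for p
        using that mult_mono[OF v_bound[of "Fcont (fst p) (snd p)"] wB[of "F t (snd p)"] C_nonneg]
        by (auto simp: k_def abs_mult)
    qed
    show "AE p in lborel \<Otimes>\<^sub>M M. p \<notin> {0..<t} \<times> space M \<longrightarrow> case_prod k p = 0"
      by (intro AE_I2) (auto simp: k_def indicator_def)
  qed
  have VG: "time_integral t x = (\<integral>r. indicator {0..<t} r * v (Fcont r x) \<partial>lborel)" for x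
    unfolding time_integral_def set_lebesgue_integral_def
  proof (rule integral_cong_AE)
    have [measurable]: "(\<lambda>r. v (Fcont r x)) \<in> borel_measurable borel" by (rule measurable_orbit)
    show "(\<lambda>r. indicator {0..t} r *\<^sub>R v (Fcont r x)) \<in> borel_measurable lborel"
      "(\<lambda>r. indicator {0..<t} r * v (Fcont r x)) \<in> borel_measurable lborel" by measurable
    show "AE r in lborel. indicator {0..t} r *\<^sub>R v (Fcont r x) = indicator {0..<t} r * v (Fcont r x)"
      using AE_lborel_singleton[of t] by eventually_elim (auto simp: indicator_def)
  qed
  have inner: "(\<integral>x. k r x \<partial>M) = indicator {0<..t} (t + (-1) * r) * correlation w (t + (-1) * r)" for r
  proof (cases "r \<in> {0..<t}")
    case True
    then have r: "0 \<le> r" "0 \<le> t - r" by auto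
    have [measurable]: "F r \<in> measurable M M" "F (t - r) \<in> measurable M M"
      using r by (auto intro: measurable_F)
    have [measurable]: "(\<lambda>x. v (Fcont r x)) \<in> borel_measurable M"
      using measurable_Pair2[OF measurable_v_Fcont, of r] by simp
    have "(\<integral>x. k r x \<partial>M) = (\<integral>x. v (F r x) * w (F (t - r) (F r x)) \<partial>M)"
    proof (rule integral_cong_AE)
      show "AE x in M. k r x = v (F r x) * w (F (t - r) (F r x))"
        using regular_points(2)
      proof eventually_elim
        case (elim x)
        then show ?case using True F_add[of "t - r" r x] r by (simp add: k_def Fcont_eq)
      qed
    qed (unfold k_def, measurable)
    also have "\<dots> = correlation w (t - r)"
      unfolding correlation_def using integral_F[OF r(1), of "\<lambda>y. v y * w (F (t - r) y)"] by simp
    finally show ?thesis using True by simp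
  next
    case False
    then have z: "indicator {0..<t} r = (0::real)" "indicator {0<..t} (t + (-1) * r) = (0::real)"
      by (auto simp: indicator_def)
    show ?thesis unfolding k_def z by simp
  qed
  have "(\<integral>x. time_integral t x * w (F t x) \<partial>M) = (\<integral>x. (\<integral>r. k r x \<partial>lborel) \<partial>M)"
    by (intro Bochner_Integration.integral_cong refl) (simp add: VG k_def)
  also have "\<dots> = (\<integral>r. (\<integral>x. k r x \<partial>M) \<partial>lborel)"
    by (rule Fubini_integral[OF kint])
  also have "\<dots> = (\<integral>r. indicator {0<..t} (t + (-1) * r) * correlation w (t + (-1) * r) \<partial>lborel)"
    by (simp only: inner)
  also have "\<dots> = (\<integral>s. indicator {0<..t} s * correlation w s \<partial>lborel)"
    by (subst lborel_integral_real_affine[where c="-1" and t=t and f="\<lambda>s. indicator {0<..t} s * correlation w s"]) auto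
  finally show ?thesis by (simp add: set_lebesgue_integral_def)
qed

definition defect :: "real \<Rightarrow> 'a \<Rightarrow> real" where
  "defect t x = time_integral t x - chi (F t x) + chi x"

lemma measurable_defect[measurable]: "0 \<le> t \<Longrightarrow> defect t \<in> borel_measurable M"
proof -
  assume "0 \<le> t"
  then have [measurable]: "F t \<in> measurable M M" by (rule measurable_F)
  show ?thesis unfolding defect_def by measurable
qed

lemma defect_bound: "0 \<le> t \<Longrightarrow> \<bar>defect t x\<bar> \<le> C * t + 2 * D"
  using time_integral_bound[of t x] chi_bound[of x] chi_bound[of "F t x"] unfolding defect_def by linarith

text \<open>The three terms contribute plus, minus and plus the integrals of the correlation function over
\<open>(0,t]\<close>, over \<open>(0,\<infinity>)\<close> and over \<open>(t,\<infinity>)\<close>. In terms of transfer operators this says that \<open>L\<^sub>t\<close> maps the defect at time \<open>t\<close> to zero.\<close>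

lemma defect_orthogonal:
  assumes t: "0 \<le> t" and [measurable]: "w \<in> borel_measurable M" and wB: "\<And>x. \<bar>w x\<bar> \<le> B"
  shows "(\<integral>x. defect t x * w (F t x) \<partial>M) = 0"
proof -
  have [measurable]: "F t \<in> measurable M M" using t by (rule measurable_F)
  have D: "0 \<le> D" using chi_bound[of undefined] by simp
  have i: "integrable M (\<lambda>x. time_integral t x * w (F t x))" "integrable M (\<lambda>x. chi (F t x) * w (F t x))"
    "integrable M (\<lambda>x. chi x * w (F t x))"
    by (rule integrable_bounded[where B="C * t * B"] integrable_bounded[where B="D * B"];
        use time_integral_bound[OF t] chi_bound wB D C_nonneg t in \<open>auto simp: abs_mult intro!: mult_mono\<close>)+
  have ci: "set_integrable lborel {0<..} (correlation w)"
    using chi_test(1)[OF assms(2) wB] .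
  have sub: "set_integrable lborel A (correlation w)" if "A \<in> sets borel" "A \<subseteq> {0<..}" for A
    using that by (intro set_integrable_subset[OF ci]) auto
  have "(\<integral>x. chi x * w (F t x) \<partial>M) = (LBINT s:{0<..}. correlation (\<lambda>x. w (F t x)) s)"
    using wB by (intro chi_test(2)) auto
  also have "\<dots> = (\<integral>s. indicator {t<..} (t + 1 * s) *\<^sub>R correlation w (t + 1 * s) \<partial>lborel)"
    unfolding set_lebesgue_integral_def
    by (intro Bochner_Integration.integral_cong) (use t in \<open>auto simp: correlation_F indicator_def\<close>)
  also have "\<dots> = (LBINT s:{t<..}. correlation w s)"
    unfolding set_lebesgue_integral_def
    by (subst lborel_integral_real_affine[where c=1 and t=t and f="\<lambda>s. indicator {t<..} s *\<^sub>R correlation w s"]) auto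
  finally have chi_F: "(\<integral>x. chi x * w (F t x) \<partial>M) = (LBINT s:{t<..}. correlation w s)" .
  have F_chi: "(\<integral>x. chi (F t x) * w (F t x) \<partial>M) = (LBINT s:{0<..}. correlation w s)"
    using integral_F[OF t, of "\<lambda>x. chi x * w x"] chi_test(2)[OF assms(2) wB] by simp
  have "(LBINT s:{0<..}. correlation w s) = (LBINT s:{0<..t} \<union> {t<..}. correlation w s)"
    using t by (simp add: ivl_disj_un_one)
  also have "\<dots> = (LBINT s:{0<..t}. correlation w s) + (LBINT s:{t<..}. correlation w s)"
    using t by (intro set_integral_Un sub) auto
  finally have split: "(LBINT s:{0<..}. correlation w s) = \<dots>" .
  have "(\<integral>x. defect t x * w (F t x) \<partial>M) =
      (\<integral>x. time_integral t x * w (F t x) - chi (F t x) * w (F t x) + chi x * w (F t x) \<partial>M)"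
    by (simp add: defect_def algebra_simps)
  also have "\<dots> = (\<integral>x. time_integral t x * w (F t x) \<partial>M) - (\<integral>x. chi (F t x) * w (F t x) \<partial>M) + (\<integral>x. chi x * w (F t x) \<partial>M)"
    using i by simp
  also have "\<dots> = 0"
    using time_integral_test[OF t assms(2) wB] chi_F F_chi split by simp
  finally show ?thesis .
qed

lemma defect_cocycle:
  assumes "0 \<le> s" "0 \<le> t"
  shows "AE x in M. defect (s + t) x = defect s x + defect t (F s x)"
  using regular_points(2) AE_F[OF assms(1) regular_points(2)]
proof eventually_elim
  case (elim x)
  then show ?case
    using time_integral_cocycle[OF assms elim] F_add[OF assms(2,1), of x] by (simp add: defect_def add.commute)
qed

text \<open>Expand the square of \<open>defect (s + t) = defect s + defect t \<circ> F\<^sub>s\<close>. On an invariant set \<open>A\<close> the cross term is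
the integral of \<open>defect s * (w \<circ> F\<^sub>s)\<close> with \<open>w = indicator A * defect t\<close>, which vanishes by orthogonality.\<close>

lemma second_moment_add:
  assumes s: "0 \<le> s" and t: "0 \<le> t" and A[measurable]: "A \<in> sets M"
    and inv: "AE x in M. F s x \<in> A \<longleftrightarrow> x \<in> A"
  shows "(\<integral>x. indicator A x * (defect (s + t) x)\<^sup>2 \<partial>M) =
    (\<integral>x. indicator A x * (defect s x)\<^sup>2 \<partial>M) + (\<integral>x. indicator A x * (defect t x)\<^sup>2 \<partial>M)"
proof -
  have [measurable]: "F s \<in> measurable M M" using s by (rule measurable_F)
  have [measurable]: "defect s \<in> borel_measurable M" "defect t \<in> borel_measurable M" "defect (s + t) \<in> borel_measurable M"
    using s t by (auto intro: measurable_defect)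
  define w where "w x = indicator A x * defect t x" for x
  have [measurable]: "w \<in> borel_measurable M" unfolding w_def by measurable
  have wB: "\<bar>w x\<bar> \<le> C * t + 2 * D" for x
    using defect_bound[OF t, of x] by (auto simp: w_def indicator_def)
  have sq: "\<bar>indicator A x * (defect r x)\<^sup>2\<bar> \<le> (C * r + 2 * D)\<^sup>2" if "0 \<le> r" for r x
    using power_mono[OF defect_bound[OF that, of x], of 2] by (auto simp: indicator_def)
  have i1: "integrable M (\<lambda>x. indicator A x * (defect s x)\<^sup>2)"
    by (rule integrable_bounded[OF _ sq[OF s]]) simp
  have i2: "integrable M (\<lambda>x. indicator A x * (defect t x)\<^sup>2)"
    by (rule integrable_bounded[OF _ sq[OF t]]) simp
  have i3: "integrable M (\<lambda>x. defect s x * w (F s x))"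
  proof (rule integrable_bounded[where B="(C * s + 2 * D) * (C * t + 2 * D)"])
    show "\<bar>defect s x * w (F s x)\<bar> \<le> (C * s + 2 * D) * (C * t + 2 * D)" for x
      unfolding abs_mult by (intro mult_mono defect_bound s wB order_trans[OF abs_ge_zero defect_bound[OF s]] abs_ge_zero)
  qed simp
  have "(\<integral>x. indicator A x * (defect (s + t) x)\<^sup>2 \<partial>M) =
      (\<integral>x. indicator A x * (defect s x)\<^sup>2 + 2 * (defect s x * w (F s x)) + indicator A (F s x) * (defect t (F s x))\<^sup>2 \<partial>M)"
  proof (rule integral_cong_AE)
    show "AE x in M. indicator A x * (defect (s + t) x)\<^sup>2 =
        indicator A x * (defect s x)\<^sup>2 + 2 * (defect s x * w (F s x)) + indicator A (F s x) * (defect t (F s x))\<^sup>2"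
      using inv defect_cocycle[OF s t]
      by eventually_elim (auto simp: w_def indicator_def power2_sum)
  qed measurable
  also have "\<dots> = (\<integral>x. indicator A x * (defect s x)\<^sup>2 \<partial>M) + 2 * (\<integral>x. defect s x * w (F s x) \<partial>M)
      + (\<integral>x. indicator A (F s x) * (defect t (F s x))\<^sup>2 \<partial>M)"
    using i1 i3 integrable_F[OF s i2] by simp
  also have "(\<integral>x. defect s x * w (F s x) \<partial>M) = 0"
    using defect_orthogonal[OF s, of w "C * t + 2 * D"] wB by simp
  also have "(\<integral>x. indicator A (F s x) * (defect t (F s x))\<^sup>2 \<partial>M) = (\<integral>x. indicator A x * (defect t x)\<^sup>2 \<partial>M)"
    using integral_F[OF s, of "\<lambda>x. indicator A x * (defect t x)\<^sup>2"] by simp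
  finally show ?thesis by simp
qed

lemma defect_0[simp]: "defect 0 x = 0"
  using time_integral_bound[of 0 x] by (simp add: defect_def)

lemma second_moment_multiple:
  assumes s: "0 \<le> s" and A: "A \<in> sets M" and inv: "AE x in M. F s x \<in> A \<longleftrightarrow> x \<in> A"
  shows "(\<integral>x. indicator A x * (defect (real n * s) x)\<^sup>2 \<partial>M) = real n * (\<integral>x. indicator A x * (defect s x)\<^sup>2 \<partial>M)"
proof (induction n)
  case (Suc n)
  have "real (Suc n) * s = s + real n * s" by (simp add: algebra_simps)
  then show ?case
    using second_moment_add[OF s _ A inv, of "real n * s"] s Suc by (simp add: algebra_simps)
qed simp

end

section \<open>Invariant sets of uniformly Hoelder paths\<close>

context continuous_semiflow begin

text \<open>The set \<open>A\<close> is contained in its preimage, which has the same finite measure.\<close>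

lemma AE_invariant_if_forward_invariant:
  assumes s: "0 \<le> s" and A[measurable]: "A \<in> sets M" and fwd: "\<And>x. x \<in> A \<Longrightarrow> F s x \<in> A"
  shows "AE x in M. F s x \<in> A \<longleftrightarrow> x \<in> A"
proof -
  have [measurable]: "F s \<in> measurable M M" using s by (rule measurable_F)
  have i: "integrable M (\<lambda>x. indicator A x :: real)"
    by (intro integrable_real_indicator) (auto simp: emeasure_eq_measure)
  have i': "integrable M (\<lambda>x. indicator A (F s x) :: real)"
    using integrable_F[OF s i] .
  have "(\<integral>x. indicator A (F s x) - indicator A x \<partial>M) = (0::real)"
    using i i' integral_F[OF s, of "indicator A"] by simp
  moreover have "integrable M (\<lambda>x. indicator A (F s x) - indicator A x :: real)"
    using i i' by (intro Bochner_Integration.integrable_diff)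
  moreover have "AE x in M. 0 \<le> (indicator A (F s x) - indicator A x :: real)"
    using fwd by (intro AE_I2) (auto simp: indicator_def)
  ultimately have "AE x in M. indicator A (F s x) - indicator A x = (0::real)"
    using integral_nonneg_eq_0_iff_AE by blast
  then show ?thesis by eventually_elim (auto simp: indicator_def split: if_splits)
qed

text \<open>Restricting to rational times makes the set measurable. Rational times suffice, as they are closed
under the addition and the division by integers that occur below.\<close>

definition rational_Holder_set :: "('a \<Rightarrow> real) \<Rightarrow> real \<Rightarrow> real \<Rightarrow> 'a set" where
  "rational_Holder_set g K \<eta> =
     {x. \<forall>s\<in>\<rat> \<inter> {0..}. \<forall>r\<in>\<rat> \<inter> {0..}. \<bar>g (F (s + r) x) - g (F s x)\<bar> \<le> K * r powr \<eta>}"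

lemma rational_Holder_set_measurable:
  assumes [measurable]: "g \<in> borel_measurable M"
  shows "rational_Holder_set g K \<eta> \<in> sets M"
proof -
  have cnt: "countable (\<rat> \<inter> {0..} :: real set)" by (intro countable_Int1 countable_rat)
  have "{x \<in> space M. \<forall>s\<in>\<rat> \<inter> {0..}. \<forall>r\<in>\<rat> \<inter> {0..}. \<bar>g (F (s + r) x) - g (F s x)\<bar> \<le> K * r powr \<eta>} \<in> sets M"
  proof (rule sets.sets_Collect_countable_All'[OF _ cnt], rule sets.sets_Collect_countable_All'[OF _ cnt])
    fix s r :: real assume "s \<in> \<rat> \<inter> {0..}" "r \<in> \<rat> \<inter> {0..}"
    then have [measurable]: "F (s + r) \<in> measurable M M" "F s \<in> measurable M M"
      by (auto intro: measurable_F)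
    show "{x \<in> space M. \<bar>g (F (s + r) x) - g (F s x)\<bar> \<le> K * r powr \<eta>} \<in> sets M" by measurable
  qed
  then show ?thesis by (simp add: rational_Holder_set_def)
qed

lemma rational_Holder_set_forward_invariant:
  assumes "x \<in> rational_Holder_set g K \<eta>" and t: "t \<in> \<rat>" "0 \<le> t"
  shows "F t x \<in> rational_Holder_set g K \<eta>"
  unfolding rational_Holder_set_def
proof (intro CollectI ballI)
  fix s r :: real assume "s \<in> \<rat> \<inter> {0..}" "r \<in> \<rat> \<inter> {0..}"
  then show "\<bar>g (F (s + r) (F t x)) - g (F s (F t x))\<bar> \<le> K * r powr \<eta>"
    using assms(1)[unfolded rational_Holder_set_def, THEN CollectD, THEN bspec, of "s + t", THEN bspec, of r] t
      F_add[of "s + r" t x] F_add[of s t x] by (simp add: add.commute add.left_commute)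
qed

end

text \<open>The expression is the square of \<open>a n\<^bsup>-1/2\<^esup> + b n\<^bsup>1/2-\<eta>\<^esup>\<close>, and both exponents are negative.\<close>

lemma scaled_square_tendsto_0:
  fixes a b \<eta> :: real
  assumes "1/2 < \<eta>"
  shows "(\<lambda>n. real n * (a * (1 / real n) + b * (1 / real n) powr \<eta>)\<^sup>2) \<longlonglongrightarrow> 0"
proof -
  have p: "(\<lambda>n. real n powr (- q)) \<longlonglongrightarrow> 0" if "0 < q" for q
    by (rule tendsto_neg_powr[OF _ filterlim_real_sequentially]) (use that in simp)
  have "(\<lambda>n. (a * real n powr (- (1/2)) + b * real n powr (- (\<eta> - 1/2)))\<^sup>2) \<longlonglongrightarrow> (a * 0 + b * 0)\<^sup>2"
    using assms by (intro tendsto_intros p) auto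
  then have lim: "(\<lambda>n. (a * real n powr (- (1/2)) + b * real n powr (- (\<eta> - 1/2)))\<^sup>2) \<longlonglongrightarrow> 0" by simp
  have "eventually (\<lambda>n. real n * (a * (1 / real n) + b * (1 / real n) powr \<eta>)\<^sup>2 =
      (a * real n powr (- (1/2)) + b * real n powr (- (\<eta> - 1/2)))\<^sup>2) sequentially"
  proof (intro eventually_sequentiallyI[of 1])
    fix n :: nat assume "1 \<le> n"
    then have n: "0 < real n" by simp
    have "real n = (real n powr (1/2))\<^sup>2"
      using n by (simp add: powr_half_sqrt)
    then have "real n * (a * (1 / real n) + b * (1 / real n) powr \<eta>)\<^sup>2 =
        (real n powr (1/2) * (a * (1 / real n) + b * (1 / real n) powr \<eta>))\<^sup>2"
      by (metis power_mult_distrib)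
    also have "real n powr (1/2) * (a * (1 / real n) + b * (1 / real n) powr \<eta>) =
        a * (real n powr (1/2) * real n powr (-1)) + b * (real n powr (1/2) * real n powr (- \<eta>))"
      using n by (simp add: powr_minus powr_divide algebra_simps inverse_eq_divide)
    also have "\<dots> = a * real n powr (- (1/2)) + b * real n powr (- (\<eta> - 1/2))"
      by (simp only: powr_add[symmetric]) simp
    finally show "real n * (a * (1 / real n) + b * (1 / real n) powr \<eta>)\<^sup>2 =
      (a * real n powr (- (1/2)) + b * real n powr (- (\<eta> - 1/2)))\<^sup>2" .
  qed
  then show ?thesis using lim by (simp add: tendsto_cong)
qed

section \<open>Vanishing of the defect\<close>

context coboundary_candidate begin

text \<open>On the invariant set of paths with Hoelder constant \<open>K\<close> the second moment at time \<open>T\<close> is \<open>n\<close> times the one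
at time \<open>T / n\<close>, hence at most \<open>n (C T / n + K (T / n)\<^bsup>\<eta>\<^esup>)\<^sup>2\<close>, which tends to zero.\<close>

lemma defect_rational_vanishes:
  assumes \<eta>: "1/2 < \<eta>" and K: "0 \<le> K" and T: "T \<in> \<rat>" "0 \<le> T"
  shows "AE x in M. x \<in> rational_Holder_set chi K \<eta> \<longrightarrow> defect T x = 0"
proof -
  define A where "A = rational_Holder_set chi K \<eta>"
  have A[measurable]: "A \<in> sets M" unfolding A_def by (rule rational_Holder_set_measurable) simp
  have [measurable]: "defect T \<in> borel_measurable M" using T by simp
  define J where "J = (\<integral>x. indicator A x * (defect T x)\<^sup>2 \<partial>M)"
  have small: "\<bar>defect \<delta> x\<bar> \<le> C * \<delta> + K * \<delta> powr \<eta>" if "\<delta> \<in> \<rat>" "0 \<le> \<delta>" "x \<in> A" for \<delta> x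
  proof -
    have "\<bar>chi (F (0 + \<delta>) x) - chi (F 0 x)\<bar> \<le> K * \<delta> powr \<eta>"
      using that(3)[unfolded A_def rational_Holder_set_def, THEN CollectD, THEN bspec, of 0, THEN bspec, of \<delta>] that(1,2)
      by simp
    then show ?thesis using time_integral_bound[OF that(2), of x] by (simp add: defect_def)
  qed
  have int: "integrable M (\<lambda>x. indicator A x * (defect T x)\<^sup>2)"
  proof (rule integrable_bounded[where B="(C * T + 2 * D)\<^sup>2"])
    show "\<bar>indicator A x * (defect T x)\<^sup>2\<bar> \<le> (C * T + 2 * D)\<^sup>2" for x
      using power_mono[OF defect_bound[OF T(2), of x], of 2] by (auto simp: indicator_def)
  qed simp
  have "J \<le> real n * ((C * T) * (1 / real n) + (K * T powr \<eta>) * (1 / real n) powr \<eta>)\<^sup>2" if "1 \<le> n" for n :: nat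
  proof -
    define \<delta> where "\<delta> = T / real n"
    have \<delta>: "\<delta> \<in> \<rat>" "0 \<le> \<delta>" using T by (auto simp: \<delta>_def)
    have [measurable]: "defect \<delta> \<in> borel_measurable M" using \<delta> by simp
    define b where "b = C * \<delta> + K * \<delta> powr \<eta>"
    have b: "0 \<le> b" using C_nonneg K \<delta> by (simp add: b_def)
    have le: "indicator A x * (defect \<delta> x)\<^sup>2 \<le> b\<^sup>2" for x
      using power_mono[OF small[OF \<delta>, of x], of 2] by (auto simp: indicator_def b_def)
    have "J = real n * (\<integral>x. indicator A x * (defect \<delta> x)\<^sup>2 \<partial>M)"
      using second_moment_multiple[OF \<delta>(2) A AE_invariant_if_forward_invariant[OF \<delta>(2) A], of n] that
        rational_Holder_set_forward_invariant \<delta> by (simp add: J_def \<delta>_def A_def)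
    also have "(\<integral>x. indicator A x * (defect \<delta> x)\<^sup>2 \<partial>M) \<le> (\<integral>x. b\<^sup>2 \<partial>M)"
    proof (rule integral_mono)
      show "integrable M (\<lambda>x. indicator A x * (defect \<delta> x)\<^sup>2)"
        by (rule integrable_bounded[where B="b\<^sup>2"]) (use le in \<open>auto simp: abs_mult\<close>)
    qed (use le in auto)
    also have "(\<integral>x. b\<^sup>2 \<partial>M) = b\<^sup>2" using prob_space by simp
    finally have "J \<le> real n * b\<^sup>2" by (simp add: mult_left_mono)
    also have "b = (C * T) * (1 / real n) + (K * T powr \<eta>) * (1 / real n) powr \<eta>"
      using T by (simp add: b_def \<delta>_def powr_divide)
    finally show ?thesis .
  qed
  then have "J \<le> 0"
    by (intro LIMSEQ_le_const[OF scaled_square_tendsto_0[OF \<eta>]]) blast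
  moreover have "0 \<le> J" unfolding J_def by (intro integral_nonneg_AE AE_I2) auto
  ultimately have "J = 0" by simp
  then have "AE x in M. indicator A x * (defect T x)\<^sup>2 = 0"
    using integral_nonneg_eq_0_iff_AE[OF int] by (simp add: J_def)
  then show ?thesis by eventually_elim (auto simp: A_def)
qed

text \<open>Countably many rational times and integer constants \<open>k\<close> share one null set. Off this set the defect
vanishes at all rational times, and it is continuous in time along paths on which \<open>chi\<close> is Hoelder.\<close>

lemma defect_vanishes:
  assumes \<eta>: "1/2 < \<eta>"
    and Hoelder: "AE x in M. \<exists>K. \<forall>s\<ge>0. \<forall>r\<ge>0. \<bar>chi (F (s + r) x) - chi (F s x)\<bar> \<le> K * r powr \<eta>"
  shows "AE x in M. \<forall>t\<ge>0. defect t x = 0"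
proof -
  have "AE x in M. \<forall>k::nat. \<forall>T\<in>\<rat> \<inter> {0..}. x \<in> rational_Holder_set chi (real k) \<eta> \<longrightarrow> defect T x = 0"
    unfolding AE_all_countable
  proof (intro allI)
    fix k :: nat
    have "countable (\<rat> \<inter> {0..} :: real set)" by (intro countable_Int1 countable_rat)
    then show "AE x in M. \<forall>T\<in>\<rat> \<inter> {0..}. x \<in> rational_Holder_set chi (real k) \<eta> \<longrightarrow> defect T x = 0"
      using defect_rational_vanishes[OF \<eta>] by (subst AE_ball_countable) auto
  qed
  with Hoelder show ?thesis
  proof eventually_elim
    case (elim x)
    then obtain K where K: "\<And>s r. 0 \<le> s \<Longrightarrow> 0 \<le> r \<Longrightarrow> \<bar>chi (F (s + r) x) - chi (F s x)\<bar> \<le> K * r powr \<eta>"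
      by blast
    obtain k :: nat where k: "K \<le> real k" using real_arch_simple by blast
    have Kk: "\<bar>chi (F (s + r) x) - chi (F s x)\<bar> \<le> real k * r powr \<eta>" if "0 \<le> s" "0 \<le> r" for s r
      using K[OF that] mult_right_mono[OF k, of "r powr \<eta>"] by simp
    then have "x \<in> rational_Holder_set chi (real k) \<eta>" by (simp add: rational_Holder_set_def)
    then have rat: "defect T x = 0" if "T \<in> \<rat>" "0 \<le> T" for T using elim(2) that by auto
    show ?case
    proof (intro allI impI)
      fix t :: real assume t: "0 \<le> t"
      have le: "\<bar>defect t x\<bar> \<le> C * (1 / real (Suc n)) + real k * (1 / real (Suc n)) powr \<eta>" for n
      proof -
        obtain T where T: "T \<in> \<rat>" "t < T" "T < t + 1 / real (Suc n)"
          using Rats_dense_in_real[of t "t + 1 / real (Suc n)"] by auto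
        define r where "r = T - t"
        have r: "0 \<le> r" "r \<le> 1 / real (Suc n)" "t + r = T" using T by (auto simp: r_def)
        have "defect T x = 0" using rat T t by auto
        then have "defect t x = - (LBINT q:{t..t + r}. v (Fcont q x)) + (chi (F (t + r) x) - chi (F t x))"
          using time_integral_split[OF t r(1), of x] r(3) by (simp add: defect_def)
        then have "\<bar>defect t x\<bar> \<le> C * r + real k * r powr \<eta>"
          using orbit_integral_bound[of t "t + r" x] Kk[OF t r(1)] r(1) by simp
        also have "\<dots> \<le> C * (1 / real (Suc n)) + real k * (1 / real (Suc n)) powr \<eta>"
          using r C_nonneg \<eta> by (intro add_mono mult_left_mono powr_mono2) auto
        finally show ?thesis .
      qed
      have inv: "(\<lambda>n. 1 / real (Suc n)) \<longlonglongrightarrow> 0"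
        by (rule LIMSEQ_Suc[OF lim_1_over_n])
      have "(\<lambda>n. C * (1 / real (Suc n)) + real k * (1 / real (Suc n)) powr \<eta>) \<longlonglongrightarrow> C * 0 + real k * 0"
        using \<eta> by (intro tendsto_add tendsto_mult tendsto_const inv tendsto_zero_powrI[OF inv tendsto_const]) auto
      then have "\<bar>defect t x\<bar> \<le> C * 0 + real k * 0"
        by (rule LIMSEQ_le_const) (use le in blast)
      then show "defect t x = 0" by simp
    qed
  qed
qed

lemma coboundary:
  assumes "1/2 < \<eta>"
    and "AE x in M. \<exists>K. \<forall>s\<ge>0. \<forall>r\<ge>0. \<bar>chi (F (s + r) x) - chi (F s x)\<bar> \<le> K * r powr \<eta>"
  shows "AE x in M. \<forall>t\<ge>0. flow_integral F v t x = chi (F t x) - chi x"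
  using defect_vanishes[OF assms] regular_points(2)
  by eventually_elim (auto simp: defect_def flow_integral_eq_time_integral)

end

section \<open>Null sets, essential suprema and Hoelder norms\<close>

text \<open>For each time \<open>r\<close> the functions \<open>v \<circ> F\<^sub>r\<close> and \<open>v' \<circ> F\<^sub>r\<close> agree almost everywhere, by invariance. Exchanging
the quantifiers over \<open>x\<close> and \<open>r\<close> by Fubini's theorem, for almost every \<open>x\<close> the integrands agree at almost
every time.\<close>
lemma (in continuous_semiflow) flow_integral_AE_cong:
  fixes v v' :: "'a \<Rightarrow> real"
  assumes [measurable]: "v \<in> borel_measurable M" "v' \<in> borel_measurable M" and eq: "AE x in M. v x = v' x"
  shows "AE x in M. \<forall>t. flow_integral F v t x = flow_integral F v' t x"
proof -
  interpret pair_sigma_finite lborel M ..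
  have Fcont_lborel: "(\<lambda>(t, x). Fcont t x) \<in> measurable (lborel \<Otimes>\<^sub>M M) M"
    using measurable_Fcont by (simp add: measurable_cong_sets[OF sets_pair_measure_cong[OF sets_lborel refl] refl])
  have Fcont_sec: "(\<lambda>r. Fcont r x) \<in> measurable lborel M" for x
  proof -
    have "(\<lambda>r. (r, x)) \<in> lborel \<rightarrow>\<^sub>M lborel \<Otimes>\<^sub>M M" by simp
    from measurable_compose[OF this Fcont_lborel] show ?thesis by simp
  qed
  have meas: "(\<lambda>p. w (Fcont (fst p) (snd p))) \<in> borel_measurable (lborel \<Otimes>\<^sub>M M)" if "w \<in> borel_measurable M" for w :: "'a \<Rightarrow> real"
    using measurable_compose[OF Fcont_lborel that] by (simp add: case_prod_beta')
  note [measurable] = meas[OF assms(1)] meas[OF assms(2)]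
  have "AE x in M. v (Fcont r x) = v' (Fcont r x)" for r
  proof -
    have "AE x in M. v (F (max 0 r) x) = v' (F (max 0 r) x)"
      using eq by (intro AE_F) auto
    with regular_points(2) show ?thesis by eventually_elim (simp add: Fcont_def)
  qed
  then have "AE r in lborel. AE x in M. v (Fcont r x) = v' (Fcont r x)" by simp
  then have "AE x in M. AE r in lborel. v (Fcont r x) = v' (Fcont r x)"
    by (subst (asm) AE_commute) measurable
  with regular_points(2) show ?thesis
  proof eventually_elim
    case (elim x)
    have Fcont: "flow_integral F w t x = (LBINT r:{0..t}. w (Fcont r x))" for t and w :: "'a \<Rightarrow> real"
      unfolding flow_integral_def using elim(1)
      by (intro set_lebesgue_integral_cong) (auto simp: Fcont_eq)
    have "(LBINT r:{0..t}. v (Fcont r x)) = (LBINT r:{0..t}. v' (Fcont r x))" for t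
      unfolding set_lebesgue_integral_def
    proof (rule integral_cong_AE)
      show "AE r in lborel. indicator {0..t} r *\<^sub>R v (Fcont r x) = indicator {0..t} r *\<^sub>R v' (Fcont r x)"
        using elim(2) by eventually_elim simp
      have [measurable]: "(\<lambda>r. v (Fcont r x)) \<in> borel_measurable lborel" "(\<lambda>r. v' (Fcont r x)) \<in> borel_measurable lborel"
        by (rule measurable_compose[OF Fcont_sec assms(1)], rule measurable_compose[OF Fcont_sec assms(2)])
      show "(\<lambda>r. indicator {0..t} r *\<^sub>R v (Fcont r x)) \<in> borel_measurable lborel"
        "(\<lambda>r. indicator {0..t} r *\<^sub>R v' (Fcont r x)) \<in> borel_measurable lborel" by measurable
    qed
    then show ?case by (simp add: Fcont)
  qed
qed

lemma borel_measurable_completion_AE: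
  assumes g: "g \<in> borel_measurable M" and eq: "AE x in M. f x = g x"
  shows "f \<in> borel_measurable (completion M)"
proof (rule measurableI)
  fix S :: "'b set" assume S: "S \<in> sets borel"
  show "f -` S \<inter> space (completion M) \<in> sets (completion M)"
  proof (rule completion.in_sets_AE)
    show "AE x in completion M. x \<in> g -` S \<inter> space M \<longleftrightarrow> x \<in> f -` S \<inter> space (completion M)"
      using AE_completion[OF eq] by eventually_elim auto
    show "g -` S \<inter> space M \<in> sets (completion M)"
      using measurable_sets[OF g S] by auto
  qed auto
qed auto

lemma AE_abs_le_Linf_norm:
  assumes "Linf_norm M g \<le> ennreal c" and "0 \<le> c"
  shows "AE x in M. \<bar>g x\<bar> \<le> c"
proof -
  have "AE x in M. ennreal \<bar>g x\<bar> \<le> Linf_norm M g"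
    using esssup_AE[of "\<lambda>x. ennreal \<bar>g x\<bar>" "completion M"] by (simp add: Linf_norm_def AE_completion_iff)
  then show ?thesis
  proof eventually_elim
    case (elim x)
    then have "ennreal \<bar>g x\<bar> \<le> ennreal c" using assms(1) by (rule order_trans)
    then show ?case using assms(2) by (simp add: ennreal_le_iff)
  qed
qed

lemma Linf_norm_le:
  assumes "g \<in> borel_measurable M" "AE x in M. f x = g x" "AE x in M. \<bar>g x\<bar> \<le> c"
  shows "Linf_norm M f \<le> ennreal c"
  unfolding Linf_norm_def
proof (rule esssup_I)
  have "f \<in> borel_measurable (completion M)"
    by (rule borel_measurable_completion_AE[OF assms(1,2)])
  then show "(\<lambda>x. ennreal \<bar>f x\<bar>) \<in> borel_measurable (completion M)" by measurable
  have "AE x in M. ennreal \<bar>f x\<bar> \<le> ennreal c"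
    using assms(2,3) by eventually_elim (simp add: ennreal_leI)
  then show "AE x in completion M. ennreal \<bar>f x\<bar> \<le> ennreal c" by (rule AE_completion)
qed

lemma holder_space_bounds:
  fixes g :: "'a::metric_space \<Rightarrow> real"
  assumes "g \<in> holder_space M \<eta>"
  defines "h \<equiv> enn2real (holder_norm M \<eta> g)"
  shows "AE x in M. \<bar>g x\<bar> \<le> h" and "\<bar>g x - g y\<bar> \<le> h * dist x y powr \<eta>"
proof -
  have h: "ennreal h = holder_norm M \<eta> g"
    using assms by (simp add: holder_space_def)
  have "Linf_norm M g \<le> ennreal h" unfolding h by (simp add: holder_norm_def)
  then show "AE x in M. \<bar>g x\<bar> \<le> h"
    by (rule AE_abs_le_Linf_norm) (simp add: h_def)
  show "\<bar>g x - g y\<bar> \<le> h * dist x y powr \<eta>"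
  proof (cases "x = y")
    case False
    then have d: "0 < dist x y powr \<eta>" by simp
    have "ennreal (\<bar>g x - g y\<bar> / dist x y powr \<eta>) \<le>
        (SUP (x, y)\<in>{(x, y). x \<noteq> y}. ennreal (\<bar>g x - g y\<bar> / dist x y powr \<eta>))"
      by (rule SUP_upper2[of "(x, y)"]) (use False in auto)
    also have "\<dots> \<le> ennreal h" unfolding h by (simp add: holder_norm_def)
    finally have "\<bar>g x - g y\<bar> / dist x y powr \<eta> \<le> h"
      by (simp add: ennreal_le_iff h_def)
    then show ?thesis using d by (simp add: field_simps)
  qed simp
qed

lemma holder_spaceI:
  fixes g :: "'a::metric_space \<Rightarrow> real"
  assumes "g \<in> borel_measurable M" and "AE x in M. \<bar>g x\<bar> \<le> c"
    and mod: "\<And>x y. \<bar>g x - g y\<bar> \<le> h * dist x y powr \<eta>"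
  shows "g \<in> holder_space M \<eta>"
proof -
  have "Linf_norm M g \<le> ennreal c"
    using assms(1,2) by (intro Linf_norm_le) auto
  moreover have "(SUP (x, y)\<in>{(x, y). x \<noteq> y}. ennreal (\<bar>g x - g y\<bar> / dist x y powr \<eta>)) \<le> ennreal h"
  proof (rule SUP_least, clarify)
    fix x y :: 'a assume "x \<noteq> y"
    then have "0 < dist x y powr \<eta>" by simp
    then have "\<bar>g x - g y\<bar> / dist x y powr \<eta> \<le> h" using mod[of x y] by (simp add: field_simps)
    then show "ennreal (\<bar>g x - g y\<bar> / dist x y powr \<eta>) \<le> ennreal h" by (rule ennreal_leI)
  qed
  ultimately have "holder_norm M \<eta> g \<le> ennreal c + ennreal h"
    unfolding holder_norm_def by (rule add_mono)
  also have "\<dots> < \<infinity>" by simp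
  finally show ?thesis by (simp add: holder_space_def)
qed

lemma continuous_on_Holder:
  fixes g :: "'a::metric_space \<Rightarrow> real"
  assumes "0 < \<eta>" and mod: "\<And>x y. \<bar>g x - g y\<bar> \<le> h * dist x y powr \<eta>"
  shows "continuous_on A g"
  unfolding continuous_on_def
proof
  fix x
  have "((\<lambda>y. dist y x powr \<eta>) \<longlongrightarrow> 0) (at x within A)"
    using assms(1) by (intro tendsto_zero_powrI[OF _ tendsto_const]) (auto intro!: tendsto_eq_intros)
  then have lim: "((\<lambda>y. h * dist y x powr \<eta>) \<longlongrightarrow> 0) (at x within A)"
    by (intro tendsto_mult_right_zero)
  have "((\<lambda>y. g y - g x) \<longlongrightarrow> 0) (at x within A)"
    by (rule Lim_null_comparison[OF always_eventually lim]) (use mod in auto)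
  then show "(g \<longlongrightarrow> g x) (at x within A)" by (rule LIM_zero_cancel)
qed

section \<open>The coboundary theorem\<close>

theorem theorem1p1:
  fixes M :: "'a::metric_space measure"
    and F :: "real \<Rightarrow> 'a \<Rightarrow> 'a"
    and L :: "real \<Rightarrow> ('a \<Rightarrow> real) \<Rightarrow> ('a \<Rightarrow> real)"
    and v :: "'a \<Rightarrow> real"
    and \<eta> :: real
  assumes "bounded (UNIV :: 'a set)"
    and "prob_space M" and "sets M = sets borel"
    and "measure_preserving_semiflow M F"
    and "AE x in M. \<exists>K. K-lipschitz_on {0..} (\<lambda>t. F t x)"
    and "\<forall>t>0. transfer_operator M (F t) (L t)"
    and "v \<in> Linf_space M"
    and "1/2 < \<eta>" and "\<eta> < 1"
    and "\<forall>t>0. L t v \<in> holder_space M \<eta>"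
    and "set_integrable lebesgue {0<..} (\<lambda>t. enn2real (holder_norm M \<eta> (L t v)))"
  shows "(\<exists>chi\<in>holder_space M \<eta>.
           has_L1_integral (restrict_space lborel {0<..}) M (\<lambda>t. L t v) chi \<and>
           (AE x in M. \<forall>t\<ge>0. flow_integral F v t x = chi (F t x) - chi x)) \<and>
         (SUP t\<in>{0..}. Linf_norm M (flow_integral F v t)) < \<infinity>"
proof -
  interpret prob_space M by (rule assms(2))
  have lip: "AE x in M. \<exists>K. K-lipschitz_on {0..} (\<lambda>t. F t x)" by (rule assms(5))
  interpret continuous_semiflow M F
  proof
    show "AE x in M. continuous_on {0..} (\<lambda>t. F t x)"
      using lip by eventually_elim (auto intro: lipschitz_on_continuous_on)
  qed (use assms in auto)

  define C where "C = enn2real (Linf_norm M v)"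
  have v_meas[measurable]: "v \<in> borel_measurable M" and v_fin: "Linf_norm M v < \<infinity>"
    using assms(7) by (auto simp: Linf_space_def)
  have C: "0 \<le> C" by (simp add: C_def)
  have v_C: "AE x in M. \<bar>v x\<bar> \<le> C"
    by (rule AE_abs_le_Linf_norm) (use v_fin in \<open>auto simp: C_def\<close>)
  \<comment> \<open>Clipping changes \<open>v\<close> on a null set only and makes it bounded everywhere.\<close>
  define v' where "v' x = max (- C) (min C (v x))" for x
  have [measurable]: "v' \<in> borel_measurable M" unfolding v'_def by measurable
  have v'_bound: "\<bar>v' x\<bar> \<le> C" for x using C by (auto simp: v'_def)
  have v_eq: "AE x in M. v x = v' x"
    using v_C by eventually_elim (auto simp: v'_def)
  have v_int: "integrable M v"
    using v_C by (intro integrable_const_bound[where B=C]) auto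
  define f where "f t = L t v" for t
  have f_int: "integrable M (f t)" if "0 < t" for t
    using assms(6) that v_int by (auto simp: f_def transfer_operator_def)
  interpret dual_orbit M F v' C f
  proof
    fix t :: real and w :: "'a \<Rightarrow> real" and B
    assume t: "0 < t" and w[measurable]: "w \<in> borel_measurable M" and wB: "\<And>x. \<bar>w x\<bar> \<le> B"
    have [measurable]: "F t \<in> measurable M M" using t by (intro measurable_F) auto
    have "Linf_norm M w \<le> ennreal B" using wB by (intro Linf_norm_le[OF w]) auto
    then have "w \<in> Linf_space M" using w by (auto simp: Linf_space_def intro: le_less_trans)
    then have "(\<integral>x. f t x * w x \<partial>M) = (\<integral>x. v x * w (F t x) \<partial>M)"
      using assms(6) t v_int by (auto simp: f_def transfer_operator_def)
    also have "\<dots> = (\<integral>x. v' x * w (F t x) \<partial>M)"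
      by (rule integral_cong_AE) (use v_eq in \<open>auto elim: eventually_mono\<close>)
    finally show "(\<integral>x. f t x * w x \<partial>M) = (\<integral>x. v' x * w (F t x) \<partial>M)" .
  qed (use v'_bound f_int in auto)

  have uc: "L1_uniformly_continuous M f" by (rule L1_uniformly_continuous_dual_orbit)
  obtain u where u: "case_prod u \<in> borel_measurable (borel \<Otimes>\<^sub>M M)"
    "\<And>t. t > 0 \<Longrightarrow> AE x in M. u t x = f t x"
    using L1_uniformly_continuous_measurable_version[OF uc] by blast

  \<comment> \<open>The Hoelder norm is Lebesgue measurable in \<open>t\<close>; \<open>H\<close> is a Borel function that agrees with it almost everywhere.\<close>
  define H0 where "H0 t = enn2real (holder_norm M \<eta> (f t))" for t
  have H0: "integrable lebesgue (\<lambda>t. indicator {0<..} t *\<^sub>R H0 t)"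
    using assms(11) by (simp add: H0_def f_def set_integrable_def)
  obtain H1 where H1[measurable]: "H1 \<in> borel_measurable lborel"
    and H1_eq: "AE t in lborel. indicator {0<..} t *\<^sub>R H0 t = H1 t"
    using completion_ex_borel_measurable_real[OF borel_measurable_integrable[OF H0]] by blast
  define H where "H t = \<bar>H1 t\<bar>" for t
  have "integrable lebesgue H1"
    using H0 AE_completion[OF H1_eq] measurable_completion[OF H1] borel_measurable_integrable[OF H0]
    by (subst integrable_cong_AE[symmetric, of _ _ H1]) auto
  then have "integrable lborel H1" by (simp add: integrable_completion)
  then have H_int: "set_integrable lborel {0<..} H"
    unfolding set_integrable_def H_def by (intro integrable_mult_indicator) auto
  have f_bound: "AE t in lborel. t > 0 \<longrightarrow>
      (AE x in M. \<bar>f t x\<bar> \<le> H t) \<and> (\<forall>x y. \<bar>f t x - f t y\<bar> \<le> H t * dist x y powr \<eta>)"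
    using H1_eq
  proof eventually_elim
    case (elim t)
    show ?case
    proof (intro impI conjI allI)
      assume "0 < t"
      then have h: "f t \<in> holder_space M \<eta>" using assms(10) by (simp add: f_def)
      have "H1 t = H0 t" using elim \<open>0 < t\<close> by simp
      then have "H t = H0 t" by (simp add: H_def H0_def)
      then show "AE x in M. \<bar>f t x\<bar> \<le> H t" "\<bar>f t x - f t y\<bar> \<le> H t * dist x y powr \<eta>" for x y
        using holder_space_bounds[OF h] by (auto simp: H0_def)
    qed
  qed
  have u_int: "integrable (lborel_pos \<Otimes>\<^sub>M M) (case_prod u)"
    by (rule integrable_measurable_version(1)[OF f_int u H_int eventually_mono[OF f_bound]]) auto
  define J where "J = (LBINT t:{0<..}. H t)"
  have "integrable M (\<lambda>x. \<integral>t. u t x \<partial>lborel_pos)"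
  proof -
    interpret N: sigma_finite_measure lborel_pos by (rule sigma_finite_lborel_pos)
    interpret pair_sigma_finite lborel_pos M ..
    show ?thesis by (rule integrable_snd[OF u_int])
  qed
  then have "\<exists>chi. (\<forall>x y. \<bar>chi x - chi y\<bar> \<le> J * dist x y powr \<eta>) \<and> (AE x in M. \<bar>chi x\<bar> \<le> J) \<and>
      (AE x in M. chi x = (\<integral>t. u t x \<partial>lborel_pos))"
    unfolding J_def
    by (intro modulus_version_of_L1_limit L1_Riemann_sum_approximation[OF uc u H_int _ _ f_bound])
      (auto simp: H_def)
  then obtain chi where chi_mod: "\<And>x y. \<bar>chi x - chi y\<bar> \<le> J * dist x y powr \<eta>"
    and chi_J: "AE x in M. \<bar>chi x\<bar> \<le> J" and chi_u: "AE x in M. chi x = (\<integral>t. u t x \<partial>lborel_pos)"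
    by blast
  have J: "0 \<le> J"
    unfolding J_def set_lebesgue_integral_def by (intro integral_nonneg_AE) (auto simp: H_def)
  have "continuous_on UNIV chi"
    using continuous_on_Holder[OF _ chi_mod] assms(8) by simp
  then have chi_meas[measurable]: "chi \<in> borel_measurable M"
    using borel_measurable_continuous_onI[of chi] by (simp add: measurable_cong_sets[OF sets_M refl])
  obtain B where B: "\<And>x y :: 'a. dist x y \<le> B"
    using assms(1) unfolding bounded_two_points by auto
  define D where "D = \<bar>chi undefined\<bar> + J * B powr \<eta>"
  have chi_D: "\<bar>chi x\<bar> \<le> D" for x
  proof -
    have "\<bar>chi x - chi undefined\<bar> \<le> J * dist x undefined powr \<eta>" by (rule chi_mod)
    also have "\<dots> \<le> J * B powr \<eta>"
      using B assms(8) J by (intro mult_left_mono powr_mono2) auto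
    finally show ?thesis by (simp add: D_def)
  qed
  interpret coboundary_candidate M F v' C f u chi D
    by unfold_locales (use u_int u(2) chi_D chi_u in auto)

  have "AE x in M. \<exists>K. \<forall>s\<ge>0. \<forall>r\<ge>0. \<bar>chi (F (s + r) x) - chi (F s x)\<bar> \<le> K * r powr \<eta>"
    using lip
  proof eventually_elim
    case (elim x)
    then obtain K where K: "K-lipschitz_on {0..} (\<lambda>t. F t x)" by blast
    have "\<bar>chi (F (s + r) x) - chi (F s x)\<bar> \<le> (J * K powr \<eta>) * r powr \<eta>" if "0 \<le> s" "0 \<le> r" for s r
    proof -
      have "\<bar>chi (F (s + r) x) - chi (F s x)\<bar> \<le> J * dist (F (s + r) x) (F s x) powr \<eta>"
        by (rule chi_mod)
      also have "\<dots> \<le> J * (K * r) powr \<eta>"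
        using lipschitz_onD[OF K, of "s + r" s] that assms(8) J
        by (intro mult_left_mono powr_mono2) (auto simp: dist_real_def)
      also have "\<dots> = (J * K powr \<eta>) * r powr \<eta>"
        using lipschitz_on_nonneg[OF K] that by (simp add: powr_mult)
      finally show ?thesis .
    qed
    then show ?case by blast
  qed
  from coboundary[OF assms(8) this] flow_integral_AE_cong[OF v_meas _ v_eq]
  have cob: "AE x in M. \<forall>t\<ge>0. flow_integral F v t x = chi (F t x) - chi x"
    by (auto elim: eventually_elim2)

  have "has_L1_integral lborel_pos M (\<lambda>t. L t v) chi"
    unfolding has_L1_integral_def
  proof (intro exI[of _ u] conjI)
    show "AE t in lborel_pos. AE x in M. u t x = L t v x"
      using u(2) by (subst AE_restrict_space_iff) (auto simp: f_def)
  qed (use u_int chi_u in auto)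
  moreover have "chi \<in> holder_space M \<eta>"
    by (rule holder_spaceI[OF chi_meas chi_J chi_mod])
  moreover have "Linf_norm M (flow_integral F v t) \<le> ennreal (2 * D)" if t: "0 \<le> t" for t
  proof (rule Linf_norm_le)
    have [measurable]: "F t \<in> measurable M M" using t by (rule measurable_F)
    show "(\<lambda>x. chi (F t x) - chi x) \<in> borel_measurable M" by measurable
    show "AE x in M. flow_integral F v t x = chi (F t x) - chi x"
      using cob by eventually_elim (use t in auto)
    show "AE x in M. \<bar>chi (F t x) - chi x\<bar> \<le> 2 * D"
    proof (intro AE_I2)
      show "\<bar>chi (F t x) - chi x\<bar> \<le> 2 * D" for x
        using chi_D[of x] chi_D[of "F t x"] by linarith
    qed
  qed
  then have "(SUP t\<in>{0..}. Linf_norm M (flow_integral F v t)) \<le> ennreal (2 * D)"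
    by (intro SUP_least) auto
  then have "(SUP t\<in>{0..}. Linf_norm M (flow_integral F v t)) < \<infinity>"
    by (rule le_less_trans) simp
  ultimately show ?thesis using cob by blast
qed

end
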